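(* Let $G$ be an instance of the rank-maximal matchings problem (with last-resort posts added) and let $M$ be a rank-maximal matching in $G$. Then every rank-maximal matching $M'$ in $G$ can be obtained from $M$ by applying to $M$ a collection of pairwise vertex-disjoint switching paths and switching cycles of the switching graph $G_M$.
   Context: An instance is a bipartite graph $G=(\mathcal{A}\cup\mathcal{P},E)$, $\mathcal{A}$ applicants, $\mathcal{P}$ posts, $E=E_1\cup\dots\cup E_r$ disjoint; $(a,p)\in E_i$ means $p$ is an $i$-th choice of $a$, $\mathrm{rank}(a,p)=i$ (ties allowed). Each applicant $a$ gets its own dummy last-resort post $\ell(a)$ with $(a,\ell(a))\in E_{r+1}$; the resulting instance is still called $G$. The signature of a matching is $(x_1,\dots,x_{r+1})$, $x_i$ the number of applicants matched along rank-$i$ edges; a matching is rank-maximal if its signature is lexicographically maximum. Even/odd/unreachable: for a bipartite graph and maximum matching $N$, a vertex is even (odd) if an even (odd) length $N$-alternating path leads to it from an $N$-unmatched vertex, unreachable otherwise; independent of $N$. Irving et al.'s algorithm: $G'_1=(\mathcal{A}\cup\mathcal{P},E_1)$, $M_1$ a maximum matching. For $i=1,\dots,r$: let $\mathcal{E}_i,\mathcal{O}_i,\mathcal{U}_i$ be the even/odd/unreachable vertices of $G'_i$; delete all edges of rank $>i$ incident to $\mathcal{O}_i\cup\mathcal{U}_i$; delete from $G'_i$ the edges joining $\mathcal{O}_i$ to $\mathcal{O}_i\cup\mathcal{U}_i$; add the remaining edges of $E_{i+1}$ to get $G'_{i+1}$; let $M_{i+1}$ be a maximum matching of $G'_{i+1}$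 augmenting $M_i$. With $\mathcal{E}_{r+1},\mathcal{O}_{r+1},\mathcal{U}_{r+1}$ the even/odd/unreachable vertices of $G'_{r+1}$, the reduced graph $G'$ is $G'_{r+1}$ minus the edges joining $\mathcal{O}_{r+1}$ to $\mathcal{O}_{r+1}\cup\mathcal{U}_{r+1}$ (independent of choices). Switching graph: for rank-maximal $M$ (which matches all applicants), $G_M$ is the directed graph on $\mathcal{P}$ with an edge $(p_i,p_j)$ whenever some applicant $a$ has $(a,p_i)\in M$ and $(a,p_j)\in E(G')$, of weight $\mathrm{rank}(a,p_j)-\mathrm{rank}(a,p_i)$. A sink is a post with no outgoing edge in $G_M$ lying in $\mathcal{E}_1\cap\dots\cap\mathcal{E}_{r+1}$. A switching path is a directed path $\langle p_0,\dots,p_{k-1}\rangle$ in $G_M$ ending in a sink with total weight $0$; a switching cycle is a directed cycle of total weight $0$. Applying a switching path $\langle p_0,\dots,p_{k-1}\rangle$ to $M$ means rematching $M(p_i)$ to $p_{i+1}$ for $0\le i\le k-2$ and leaving all other applicants unchanged; applying a switching cycle $\langle p_0,\dots,p_{k-1},p_0\rangle$ means rematching $M(p_i)$ to $p_{i+1 \bmod k}$. *)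

theory Defs
  imports Main
begin

section \<open>Generic bipartite graphs: applicants 'a, posts 'q, edges ('a \<times> 'q) set\<close>

definition matching :: "('a \<times> 'q) set \<Rightarrow> ('a \<times> 'q) set \<Rightarrow> bool" where
  "matching F N \<longleftrightarrow> N \<subseteq> F \<and>
     (\<forall>a q q'. (a,q) \<in> N \<longrightarrow> (a,q') \<in> N \<longrightarrow> q = q') \<and>
     (\<forall>a a' q. (a,q) \<in> N \<longrightarrow> (a',q) \<in> N \<longrightarrow> a = a')"

definition max_matching :: "('a \<times> 'q) set \<Rightarrow> ('a \<times> 'q) set \<Rightarrow> bool" where
  "max_matching F N \<longleftrightarrow> matching F N \<and> (\<forall>N'. matching F N' \<longrightarrow> card N' \<le> card N)"

text \<open>Vertices of the bipartite graph are of type 'a + 'q (Inl = applicant, Inr = post).\<close>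
definition adjE :: "('a \<times> 'q) set \<Rightarrow> 'a + 'q \<Rightarrow> 'a + 'q \<Rightarrow> bool" where
  "adjE F u v \<longleftrightarrow> (\<exists>a q. (a,q) \<in> F \<and> ((u = Inl a \<and> v = Inr q) \<or> (u = Inr q \<and> v = Inl a)))"

definition alt_path :: "'a set \<Rightarrow> 'q set \<Rightarrow> ('a \<times> 'q) set \<Rightarrow> ('a \<times> 'q) set \<Rightarrow> ('a + 'q) list \<Rightarrow> bool" where
  "alt_path A Q F N xs \<longleftrightarrow> xs \<noteq> [] \<and> distinct xs \<and> set xs \<subseteq> Inl ` A \<union> Inr ` Q \<and>
     \<not> (\<exists>w. adjE N (hd xs) w) \<and>
     (\<forall>i. Suc i < length xs \<longrightarrow> adjE F (xs ! i) (xs ! Suc i) \<and>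
                                 (adjE N (xs ! i) (xs ! Suc i) \<longleftrightarrow> odd i))"

text \<open>A fixed maximum matching (the classification is independent of the choice).\<close>
definition some_max :: "('a \<times> 'q) set \<Rightarrow> ('a \<times> 'q) set" where
  "some_max F = (SOME N. max_matching F N)"

definition even_set :: "'a set \<Rightarrow> 'q set \<Rightarrow> ('a \<times> 'q) set \<Rightarrow> ('a + 'q) set" where
  "even_set A Q F = {v. \<exists>xs. alt_path A Q F (some_max F) xs \<and> last xs = v \<and> even (length xs - 1)}"

definition odd_set :: "'a set \<Rightarrow> 'q set \<Rightarrow> ('a \<times> 'q) set \<Rightarrow> ('a + 'q) set" where
  "odd_set A Q F = {v. \<exists>xs. alt_path A Q F (some_max F) xs \<and> last xs = v \<and> odd (length xs - 1)}"

definition unr_set :: "'a set \<Rightarrow> 'q set \<Rightarrow> ('a \<times> 'q) set \<Rightarrow> ('a + 'q) set" where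
  "unr_set A Q F = (Inl ` A \<union> Inr ` Q) - even_set A Q F - odd_set A Q F"

definition bad_edges :: "'a set \<Rightarrow> 'q set \<Rightarrow> ('a \<times> 'q) set \<Rightarrow> ('a \<times> 'q) set" where
  "bad_edges A Q F = {(a,q) \<in> F.
      (Inl a \<in> odd_set A Q F \<and> Inr q \<in> odd_set A Q F \<union> unr_set A Q F) \<or>
      (Inr q \<in> odd_set A Q F \<and> Inl a \<in> odd_set A Q F \<union> unr_set A Q F)}"

definition rank_edges :: "('a \<times> 'q) set \<Rightarrow> ('a \<Rightarrow> 'q \<Rightarrow> nat) \<Rightarrow> nat \<Rightarrow> ('a \<times> 'q) set" where
  "rank_edges F \<rho> i = {(a,q) \<in> F. \<rho> a q = i}"

text \<open>Irving et al.'s algorithm. irving_st k = (G'_(k+1), union of O_j \<union> U_j for j \<le> k).\<close>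
fun irving_st :: "'a set \<Rightarrow> 'q set \<Rightarrow> ('a \<times> 'q) set \<Rightarrow> ('a \<Rightarrow> 'q \<Rightarrow> nat) \<Rightarrow> nat
                   \<Rightarrow> ('a \<times> 'q) set \<times> ('a + 'q) set" where
  "irving_st A Q F \<rho> 0 = (rank_edges F \<rho> 1, {})"
| "irving_st A Q F \<rho> (Suc k) =
     (let H = fst (irving_st A Q F \<rho> k);
          D = snd (irving_st A Q F \<rho> k) \<union> odd_set A Q H \<union> unr_set A Q H
      in ((H - bad_edges A Q H) \<union>
          {(a,q) \<in> rank_edges F \<rho> (k + 2). Inl a \<notin> D \<and> Inr q \<notin> D}, D))"

text \<open>G'_i for i \<ge> 1.\<close>
definition Gi :: "'a set \<Rightarrow> 'q set \<Rightarrow> ('a \<times> 'q) set \<Rightarrow> ('a \<Rightarrow> 'q \<Rightarrow> nat) \<Rightarrow> nat \<Rightarrow> ('a \<times> 'q) set" where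
  "Gi A Q F \<rho> i = fst (irving_st A Q F \<rho> (i - 1))"

definition reduced :: "'a set \<Rightarrow> 'q set \<Rightarrow> ('a \<times> 'q) set \<Rightarrow> ('a \<Rightarrow> 'q \<Rightarrow> nat) \<Rightarrow> nat \<Rightarrow> ('a \<times> 'q) set" where
  "reduced A Q F \<rho> r = Gi A Q F \<rho> (r + 1) - bad_edges A Q (Gi A Q F \<rho> (r + 1))"

definition signature :: "('a \<Rightarrow> 'q \<Rightarrow> nat) \<Rightarrow> nat \<Rightarrow> ('a \<times> 'q) set \<Rightarrow> nat list" where
  "signature \<rho> r M = map (\<lambda>i. card {(a,q) \<in> M. \<rho> a q = i}) [1..<r + 2]"

definition lex_gt :: "nat list \<Rightarrow> nat list \<Rightarrow> bool" where
  "lex_gt xs ys \<longleftrightarrow> (\<exists>i < length xs. i < length ys \<and> (\<forall>j < i. xs ! j = ys ! j) \<and> xs ! i > ys ! i)"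

definition rank_maximal :: "('a \<times> 'q) set \<Rightarrow> ('a \<Rightarrow> 'q \<Rightarrow> nat) \<Rightarrow> nat \<Rightarrow> ('a \<times> 'q) set \<Rightarrow> bool" where
  "rank_maximal F \<rho> r M \<longleftrightarrow> matching F M \<and>
     \<not> (\<exists>N. matching F N \<and> lex_gt (signature \<rho> r N) (signature \<rho> r M))"

definition mate :: "('a \<times> 'q) set \<Rightarrow> 'q \<Rightarrow> 'a" where
  "mate M q = (THE a. (a,q) \<in> M)"

definition sw_edge :: "'a set \<Rightarrow> 'q set \<Rightarrow> ('a \<times> 'q) set \<Rightarrow> ('a \<Rightarrow> 'q \<Rightarrow> nat) \<Rightarrow> nat
                        \<Rightarrow> ('a \<times> 'q) set \<Rightarrow> 'q \<Rightarrow> 'q \<Rightarrow> bool" where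
  "sw_edge A Q F \<rho> r M q q' \<longleftrightarrow> q \<in> Q \<and> q' \<in> Q \<and> q \<noteq> q' \<and>
     (\<exists>a. (a,q) \<in> M \<and> (a,q') \<in> reduced A Q F \<rho> r)"

definition sw_weight :: "('a \<Rightarrow> 'q \<Rightarrow> nat) \<Rightarrow> ('a \<times> 'q) set \<Rightarrow> 'q \<Rightarrow> 'q \<Rightarrow> int" where
  "sw_weight \<rho> M q q' = int (\<rho> (mate M q) q') - int (\<rho> (mate M q) q)"

definition is_sink :: "'a set \<Rightarrow> 'q set \<Rightarrow> ('a \<times> 'q) set \<Rightarrow> ('a \<Rightarrow> 'q \<Rightarrow> nat) \<Rightarrow> nat
                        \<Rightarrow> ('a \<times> 'q) set \<Rightarrow> 'q \<Rightarrow> bool" where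
  "is_sink A Q F \<rho> r M q \<longleftrightarrow> q \<in> Q \<and> (\<forall>q'. \<not> sw_edge A Q F \<rho> r M q q') \<and>
     (\<forall>i \<in> {1..r + 1}. Inr q \<in> even_set A Q (Gi A Q F \<rho> i))"

definition switching_path :: "'a set \<Rightarrow> 'q set \<Rightarrow> ('a \<times> 'q) set \<Rightarrow> ('a \<Rightarrow> 'q \<Rightarrow> nat) \<Rightarrow> nat
                        \<Rightarrow> ('a \<times> 'q) set \<Rightarrow> 'q list \<Rightarrow> bool" where
  "switching_path A Q F \<rho> r M qs \<longleftrightarrow> qs \<noteq> [] \<and> distinct qs \<and> set qs \<subseteq> Q \<and>
     (\<forall>i. Suc i < length qs \<longrightarrow> sw_edge A Q F \<rho> r M (qs ! i) (qs ! Suc i)) \<and>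
     is_sink A Q F \<rho> r M (last qs) \<and>
     (\<Sum>i < length qs - 1. sw_weight \<rho> M (qs ! i) (qs ! Suc i)) = 0"

text \<open>A cycle \<langle>p_0,...,p_(k-1),p_0\<rangle> is represented by the list [p_0,...,p_(k-1)].\<close>
definition switching_cycle :: "'a set \<Rightarrow> 'q set \<Rightarrow> ('a \<times> 'q) set \<Rightarrow> ('a \<Rightarrow> 'q \<Rightarrow> nat) \<Rightarrow> nat
                        \<Rightarrow> ('a \<times> 'q) set \<Rightarrow> 'q list \<Rightarrow> bool" where
  "switching_cycle A Q F \<rho> r M qs \<longleftrightarrow> qs \<noteq> [] \<and> distinct qs \<and> set qs \<subseteq> Q \<and>
     (\<forall>i < length qs. sw_edge A Q F \<rho> r M (qs ! i) (qs ! (Suc i mod length qs))) \<and>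
     (\<Sum>i < length qs. sw_weight \<rho> M (qs ! i) (qs ! (Suc i mod length qs))) = 0"

definition moves :: "'q list set \<Rightarrow> 'q list set \<Rightarrow> ('q \<times> 'q) set" where
  "moves Ps Cs = {(xs ! i, xs ! Suc i) | xs i. xs \<in> Ps \<and> Suc i < length xs} \<union>
                 {(xs ! i, xs ! (Suc i mod length xs)) | xs i. xs \<in> Cs \<and> i < length xs}"

definition apply_switch :: "('a \<times> 'q) set \<Rightarrow> ('q \<times> 'q) set \<Rightarrow> ('a \<times> 'q) set" where
  "apply_switch M S = {(a,q) \<in> M. q \<notin> Domain S} \<union> {(a,q'). \<exists>q. (a,q) \<in> M \<and> (q,q') \<in> S}"

definition instance_wf :: "'a set \<Rightarrow> 'p set \<Rightarrow> ('a \<times> 'p) set \<Rightarrow> ('a \<Rightarrow> 'p \<Rightarrow> nat) \<Rightarrow> nat \<Rightarrow> bool" where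
  "instance_wf A P E rk r \<longleftrightarrow> finite A \<and> finite P \<and> E \<subseteq> A \<times> P \<and>
     (\<forall>(a,p) \<in> E. 1 \<le> rk a p \<and> rk a p \<le> r)"

text \<open>Posts of the extended instance: Inl p for original posts, Inr a = \<ell>(a).\<close>
definition lr_posts :: "'a set \<Rightarrow> 'p set \<Rightarrow> ('p + 'a) set" where
  "lr_posts A P = Inl ` P \<union> Inr ` A"

definition lr_edges :: "'a set \<Rightarrow> ('a \<times> 'p) set \<Rightarrow> ('a \<times> ('p + 'a)) set" where
  "lr_edges A E = {(a, Inl p) | a p. (a,p) \<in> E} \<union> {(a, Inr a) | a. a \<in> A}"

definition lr_rank :: "('a \<Rightarrow> 'p \<Rightarrow> nat) \<Rightarrow> nat \<Rightarrow> 'a \<Rightarrow> 'p + 'a \<Rightarrow> nat" where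
  "lr_rank rk r a q = (case q of Inl p \<Rightarrow> rk a p | Inr _ \<Rightarrow> r + 1)"

end

(* All applicants are matched in M and M', so every component of their symmetric difference is an
   alternating cycle, or an even path from a post free in M' to a post free in M. On the posts this is
   a decomposition of the partial injection "M-partner to M'-partner" into paths and cycles.

   Weights: exchanging M and M' on one component gives two matchings N, N' whose signatures add up to
   twice the maximal one. Neither exceeds it lexicographically, so N has the signature of M, and the
   ranks on the component sum up to the same value for M and M'.

   Edges and sinks: by induction on i, the edges of rank at most i of a rank-maximal matching form a
   maximum matching of G'_i. A matching of G'_i is maximum iff it covers all odd and unreachable
   vertices and avoids the deleted edges. Hence an augmentation in G'_i of a matching that is maximum
   at all earlier levels remains maximum at these levels, and would improve the signature. So M and M'
   lie in the reduced graph, and a post that is free in M is even at every level. *)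
theory Submission
  imports Defs
begin

section \<open>Matched vertices, adjacency and maximum matchings\<close>

definition verts :: "('a \<times> 'q) set \<Rightarrow> ('a + 'q) set" where
  "verts N = Inl ` Domain N \<union> Inr ` Range N"

lemma verts_iff [simp]:
  "Inl a \<in> verts N \<longleftrightarrow> (\<exists>q. (a,q) \<in> N)"
  "Inr q \<in> verts N \<longleftrightarrow> (\<exists>a. (a,q) \<in> N)"
  by (auto simp: verts_def)

lemma verts_iff_adjE: "v \<in> verts N \<longleftrightarrow> (\<exists>w. adjE N v w)"
  by (cases v) (auto simp: adjE_def)

lemma adjE_simps [simp]:
  "adjE N (Inl a) (Inr q) \<longleftrightarrow> (a,q) \<in> N"
  "adjE N (Inr q) (Inl a) \<longleftrightarrow> (a,q) \<in> N"
  "\<not> adjE N (Inl a) (Inl b)"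
  "\<not> adjE N (Inr q) (Inr p)"
  by (auto simp: adjE_def)

lemma adjE_isl: "adjE F u v \<Longrightarrow> isl v \<longleftrightarrow> \<not> isl u"
  by (auto simp: adjE_def)

lemma matching_eq1: "matching F N \<Longrightarrow> (a,q) \<in> N \<Longrightarrow> (a,q') \<in> N \<Longrightarrow> q = q'"
  and matching_eq2: "matching F N \<Longrightarrow> (a,q) \<in> N \<Longrightarrow> (a',q) \<in> N \<Longrightarrow> a = a'"
  and matching_subset: "matching F N \<Longrightarrow> N \<subseteq> F"
  unfolding matching_def by blast+

lemma matching_mono: "matching F N \<Longrightarrow> N' \<subseteq> N \<Longrightarrow> N' \<subseteq> F' \<Longrightarrow> matching F' N'"
  unfolding matching_def by blast

lemma max_matching_some_max:
  assumes "finite F"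
  shows "max_matching F (some_max F)"
proof -
  have "matching F {}" by (simp add: matching_def)
  moreover have "card N < Suc (card F)" if "matching F N" for N
    using that assms by (simp add: card_mono matching_subset less_Suc_eq_le)
  ultimately have "\<exists>N. max_matching F N"
    unfolding max_matching_def
    using ex_has_greatest_nat[of "matching F" "{}" card "Suc (card F)"] by blast
  then show ?thesis
    unfolding some_max_def by (rule someI_ex)
qed


section \<open>Augmenting paths\<close>

text \<open>The list holds only the posts of an alternating walk that leads from the applicant to an
  unmatched post.\<close>
inductive augmenting :: "('a \<times> 'q) set \<Rightarrow> ('a \<times> 'q) set \<Rightarrow> 'a \<Rightarrow> 'q list \<Rightarrow> bool"
  for F S where
  last: "(a,q) \<in> F \<Longrightarrow> q \<notin> Range S \<Longrightarrow> augmenting F S a [q]"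
| step: "(a,q) \<in> F \<Longrightarrow> (b,q) \<in> S \<Longrightarrow> augmenting F S b qs \<Longrightarrow> q \<notin> set qs
         \<Longrightarrow> augmenting F S a (q # qs)"

text \<open>The part of the walk from \<open>q\<close> onwards also serves \<open>a\<close>; being a
  suffix, it keeps its posts distinct.\<close>

lemma augmenting_shortcut:
  assumes "augmenting F S b qs" "q \<in> set qs" "(a,q) \<in> F"
  shows "\<exists>qs'. augmenting F S a qs'"
  using assms by induction (auto intro: augmenting.intros)

text \<open>Removes the distinctness condition of rule \<open>step\<close>: if \<open>q\<close>
  already occurs later, the walk is shortened instead.\<close>

lemma augmenting_extend:
  assumes "augmenting F S b qs" "(b,q) \<in> S" "(a,q) \<in> F"
  shows "\<exists>qs'. augmenting F S a qs'"
  using assms augmenting_shortcut augmenting.step by metis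

lemma augmenting_cong:
  assumes "augmenting F S b qs" "\<And>c p. p \<in> set qs \<Longrightarrow> (c,p) \<in> S \<longleftrightarrow> (c,p) \<in> T"
  shows "augmenting F T b qs"
  using assms by induction (auto intro!: augmenting.intros)

text \<open>Augmentation proceeds one post at a time, so the induction runs over all matchings
  \<open>S\<close>. Besides the larger size it records that no matched vertex becomes unmatched,
  which later keeps vertices covered at earlier levels.\<close>

lemma augment:
  assumes "augmenting F S a qs" "matching F S" "finite S" "a \<notin> Domain S"
  shows "\<exists>K. matching F K \<and> card K = Suc (card S) \<and> insert (Inl a) (verts S) \<subseteq> verts K"
  using assms
proof (induction qs arbitrary: a S rule: list.induct)
  case Nil
  then show ?case by (auto elim: augmenting.cases)
next
  case (Cons q qs)
  from Cons.prems(1) show ?case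
  proof cases
    case last
    have "matching F (insert (a,q) S)"
      using last Cons.prems unfolding matching_def by blast
    moreover have "(a,q) \<notin> S" using Cons.prems by auto
    then have "card (insert (a,q) S) = Suc (card S)" using Cons.prems by simp
    ultimately show ?thesis
      using last(1) by (intro exI[of _ "insert (a,q) S"]) (auto simp: verts_def simp del: card_insert_if)
  next
    case (step b)
    \<comment> \<open>Handing \<open>q\<close> from \<open>b\<close> to \<open>a\<close> keeps the
      size and leaves \<open>b\<close> as the unmatched applicant from which the rest of the walk
      starts.\<close>
    let ?S = "insert (a,q) (S - {(b,q)})"
    have "matching F ?S"
      using step(1,2) Cons.prems unfolding matching_def by blast
    moreover have c: "card ?S = card S"
    proof -
      have "(a,q) \<notin> S - {(b,q)}" using Cons.prems by auto
      then show ?thesis using step(2) Cons.prems(3)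
        by (metis card_Suc_Diff1 card_insert_disjoint finite_Diff)
    qed
    moreover have "b \<notin> Domain ?S"
      using step(2) Cons.prems by (auto dest: matching_eq1)
    moreover have "augmenting F ?S b qs"
      using step(4) by (intro augmenting_cong[OF step(3)]) auto
    ultimately obtain K where K: "matching F K" "card K = Suc (card S)"
        "insert (Inl b) (verts ?S) \<subseteq> verts K"
      using Cons.IH[of ?S b] Cons.prems(3) by auto
    have "insert (Inl a) (verts S) \<subseteq> insert (Inl b) (verts ?S)"
      by (auto simp: verts_def)
    then show ?thesis using K by blast
  qed
qed

section \<open>Matchings compared with vertex covers\<close>

lemma card_Int_verts:
  assumes "matching F N" "finite N"
  shows "card (C \<inter> verts N) = (\<Sum>(a,q)\<in>N. card ({Inl a, Inr q} \<inter> C))"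
proof -
  have "C \<inter> verts N = (\<Union>e\<in>N. {Inl (fst e), Inr (snd e)} \<inter> C)"
    by (force simp: verts_def)
  also have "card \<dots> = (\<Sum>e\<in>N. card ({Inl (fst e), Inr (snd e)} \<inter> C))"
    using assms by (intro card_UN_disjoint) (auto dest: matching_eq1 matching_eq2)
  finally show ?thesis by (simp add: case_prod_beta)
qed

text \<open>Weak duality with its equality case. Every edge of \<open>N\<close> contains at least
  one vertex of \<open>C\<close>, and different edges share no vertex; if the sizes agree, no vertex
  of \<open>C\<close> is left unmatched and no edge contains two.\<close>

lemma card_le_cover:
  assumes "matching F N" "finite N" "finite C"
    and cover: "\<And>a q. (a,q) \<in> N \<Longrightarrow> Inl a \<in> C \<or> Inr q \<in> C"
  shows "card N \<le> card C"
    and "card C \<le> card N \<Longrightarrow> C \<subseteq> verts N"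
    and "card C \<le> card N \<Longrightarrow> (a,q) \<in> N \<Longrightarrow> \<not> (Inl a \<in> C \<and> Inr q \<in> C)"
proof -
  have ge1: "1 \<le> (case e of (a,q) \<Rightarrow> card ({Inl a, Inr q} \<inter> C))" if "e \<in> N" for e
    using cover that by (cases e) (auto simp: Suc_le_eq card_gt_0_iff)
  have "card N = (\<Sum>e\<in>N. 1)" by simp
  also have "\<dots> \<le> (\<Sum>(a,q)\<in>N. card ({Inl a, Inr q} \<inter> C))"
    using ge1 by (rule sum_mono)
  finally have 1: "card N \<le> card (C \<inter> verts N)" by (simp add: card_Int_verts[OF assms(1,2)])
  also have 2: "\<dots> \<le> card C" using assms(3) by (simp add: card_mono)
  finally show "card N \<le> card C" .
  assume 3: "card C \<le> card N"
  then have "card (C \<inter> verts N) = card C" using 1 2 by simp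
  then show "C \<subseteq> verts N" using assms(3) by (metis card_subset_eq inf.absorb_iff1 inf_le1)
  assume aq: "(a,q) \<in> N"
  show "\<not> (Inl a \<in> C \<and> Inr q \<in> C)"
  proof
    assume "Inl a \<in> C \<and> Inr q \<in> C"
    then have "{Inl a, Inr q} \<inter> C = {Inl a, Inr q}" by auto
    then have "1 < card ({Inl a, Inr q} \<inter> C)" by simp
    then have "(\<Sum>e\<in>N. 1) < (\<Sum>(a,q)\<in>N. card ({Inl a, Inr q} \<inter> C))"
      using aq by (intro sum_strict_mono_ex1 assms(2) ballI ge1 bexI[OF _ aq]) auto
    then show False using 2 3 by (simp add: card_Int_verts[OF assms(1,2)])
  qed
qed

lemma card_eq_cover:
  assumes "matching F N" "finite N" "C \<subseteq> verts N"
    and "\<And>a q. (a,q) \<in> N \<Longrightarrow> (Inl a \<in> C) \<noteq> (Inr q \<in> C)"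
  shows "card N = card C"
proof -
  have "card C = (\<Sum>(a,q)\<in>N. card ({Inl a, Inr q} \<inter> C))"
    using card_Int_verts[OF assms(1,2), of C] assms(3) by (simp add: inf.absorb1)
  also have "\<dots> = (\<Sum>e\<in>N. 1)"
  proof (intro sum.cong refl)
    fix e assume "e \<in> N"
    obtain a q where e: "e = (a,q)" by (cases e)
    have "\<exists>x. {Inl a, Inr q} \<inter> C = {x}"
      using assms(4)[of a q] \<open>e \<in> N\<close> e by (cases "Inl a \<in> C") auto
    then show "(case e of (a,q) \<Rightarrow> card ({Inl a, Inr q} \<inter> C)) = 1"
      unfolding e prod.case card_1_singleton_iff One_nat_def .
  qed
  finally show ?thesis by simp
qed

section \<open>Even, odd and unreachable vertices\<close>

text \<open>Alternating walks instead of simple paths: vertices may repeat, and \<open>out\<close>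
  may even use an edge of \<open>S\<close>. This gives closure rules without freshness conditions;
  \<open>ev_iff\<close> and \<open>od_iff\<close> show that the same vertices are reached as by
  \<open>alt_path\<close>.\<close>

inductive alt_even and alt_odd for V F S where
  free: "v \<in> V \<Longrightarrow> v \<notin> verts S \<Longrightarrow> alt_even V F S v"
| out: "alt_even V F S u \<Longrightarrow> adjE F u v \<Longrightarrow> alt_odd V F S v"
| matched: "alt_odd V F S u \<Longrightarrow> adjE S u v \<Longrightarrow> alt_even V F S v"

locale bipartite_matching =
  fixes A :: "'a set" and Q :: "'q set" and F S :: "('a \<times> 'q) set"
  assumes finA: "finite A" and finQ: "finite Q" and F: "F \<subseteq> A \<times> Q" and m: "matching F S"
begin

abbreviation "V \<equiv> Inl ` A \<union> Inr ` Q"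
abbreviation "ev \<equiv> alt_even V F S"
abbreviation "od \<equiv> alt_odd V F S"

lemma SF: "S \<subseteq> F" using m by (rule matching_subset)
lemma finF: "finite F" using finA finQ F by (meson finite_SigmaI finite_subset)
lemma finS: "finite S" using finF SF by (rule finite_subset[rotated])

lemma adjE_V: "adjE F u v \<Longrightarrow> v \<in> V"
  using F by (auto simp: adjE_def)

lemma od_V: "alt_odd V F S v \<Longrightarrow> v \<in> V"
  using adjE_V by (blast elim: alt_odd.cases)

lemma adjE_S_F: "adjE S u v \<Longrightarrow> adjE F u v"
  using SF by (auto simp: adjE_def)

lemma adjE_sym: "adjE S u v \<longleftrightarrow> adjE S v u"
  by (auto simp: adjE_def)

lemma adjE_S_unique: "adjE S u v \<Longrightarrow> adjE S u w \<Longrightarrow> v = w"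
  using m by (auto simp: adjE_def dest: matching_eq1 matching_eq2)

lemma alt_path_nth:
  assumes "alt_path A Q F S xs" "i < length xs"
  shows "if even i then ev (xs ! i) else od (xs ! i)"
  using assms(2)
proof (induction i)
  case 0
  with assms(1) have "xs ! 0 \<in> V" "xs ! 0 \<notin> verts S"
    using assms(1) nth_mem[of 0 xs] unfolding alt_path_def verts_iff_adjE
    by (auto simp: hd_conv_nth simp del: nth_mem)
  then show ?case by (simp add: free)
next
  case (Suc i)
  then show ?case
    using assms(1) unfolding alt_path_def
    by (auto split: if_splits intro: matched out)
qed

text \<open>Sides alternate along a path, so the side of a vertex fixes the parity of its
  position.\<close>

lemma alt_path_isl:
  assumes "alt_path A Q F S xs" "i < length xs"
  shows "isl (xs ! i) \<longleftrightarrow> isl (hd xs) = even i"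
  using assms(2)
proof (induction i)
  case 0
  then show ?case by (simp add: hd_conv_nth)
next
  case (Suc i)
  then have "adjE F (xs ! i) (xs ! Suc i)"
    using assms(1) unfolding alt_path_def by blast
  then show ?case using Suc adjE_isl by fastforce
qed

lemma alt_path_take:
  assumes "alt_path A Q F S xs" "i < length xs"
  shows "alt_path A Q F S (take (Suc i) xs)" "last (take (Suc i) xs) = xs ! i"
proof -
  show "alt_path A Q F S (take (Suc i) xs)"
    using assms unfolding alt_path_def by (auto dest: in_set_takeD)
  show "last (take (Suc i) xs) = xs ! i"
    using assms(2) by (simp add: take_Suc_conv_app_nth)
qed

lemma alt_path_snoc:
  assumes "alt_path A Q F S xs" "v \<notin> set xs" "adjE F (last xs) v"
    "adjE S (last xs) v \<longleftrightarrow> odd (length xs - 1)"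
  shows "alt_path A Q F S (xs @ [v])"
  unfolding alt_path_def
proof (intro conjI allI impI)
  have xs: "xs \<noteq> []" using assms(1) by (simp add: alt_path_def)
  show "set (xs @ [v]) \<subseteq> V"
    using assms(1) adjE_V[OF assms(3)] by (auto simp: alt_path_def)
  fix i assume i: "Suc i < length (xs @ [v])"
  have "adjE F ((xs @ [v]) ! i) ((xs @ [v]) ! Suc i) \<and>
      (adjE S ((xs @ [v]) ! i) ((xs @ [v]) ! Suc i) \<longleftrightarrow> odd i)"
  proof (cases "Suc i < length xs")
    case True
    then show ?thesis using assms(1) by (simp add: alt_path_def nth_append)
  next
    case False
    then have "i = length xs - 1" using i by simp
    then show ?thesis using assms(3,4) xs by (simp add: nth_append last_conv_nth)
  qed
  then show "adjE F ((xs @ [v]) ! i) ((xs @ [v]) ! Suc i)"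
    and "adjE S ((xs @ [v]) ! i) ((xs @ [v]) ! Suc i) \<longleftrightarrow> odd i" by auto
qed (use assms in \<open>auto simp: alt_path_def\<close>)

text \<open>If the new vertex already lies on the path, bipartiteness fixes its parity there, so a prefix
  of the path reaches it.\<close>
lemma alt_path_reaches:
  "ev v \<Longrightarrow> \<exists>xs. alt_path A Q F S xs \<and> last xs = v \<and> even (length xs - 1)"
  "od v \<Longrightarrow> \<exists>xs. alt_path A Q F S xs \<and> last xs = v \<and> odd (length xs - 1)"
proof (induction rule: alt_even_alt_odd.inducts)
  case (free v)
  then show ?case
    by (intro exI[of _ "[v]"]) (auto simp: alt_path_def verts_iff_adjE)
next
  case (out u v)
  then obtain xs where xs: "alt_path A Q F S xs" "last xs = u" "even (length xs - 1)" by auto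
  have ne: "xs \<noteq> []" using xs by (simp add: alt_path_def)
  show ?case
  proof (cases "v \<in> set xs")
    case True
    then obtain i where i: "i < length xs" "v = xs ! i" by (auto simp: in_set_conv_nth)
    have "odd i"
      using alt_path_isl[OF xs(1) i(1)] alt_path_isl[OF xs(1), of "length xs - 1"]
        adjE_isl[OF out(3)] xs(2,3) ne i(2) by (auto simp: last_conv_nth)
    then show ?thesis
      using alt_path_take[OF xs(1) i(1)] i by (intro exI[of _ "take (Suc i) xs"]) auto
  next
    case False
    \<comment> \<open>A matching edge at \<open>u\<close> is either impossible, since
      \<open>u\<close> is the unmatched start, or the one by which the path arrives at
      \<open>u\<close>; its other end lies on the path, whereas \<open>v\<close> does not.\<close>
    have "\<not> adjE S u v"
    proof
      assume uv: "adjE S u v"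
      show False
      proof (cases "length xs - 1")
        case 0
        then have "hd xs = u" using xs(2) ne by (cases xs) auto
        then show False using xs(1) uv by (auto simp: alt_path_def)
      next
        case (Suc n)
        then have "adjE S (xs ! n) (xs ! Suc n)"
          using xs(1,3) by (auto simp: alt_path_def)
        moreover have "xs ! Suc n = u" using Suc xs(2) ne by (auto simp: last_conv_nth)
        ultimately have "xs ! n = v" using uv adjE_S_unique adjE_sym[of "xs ! n" u] by simp
        moreover have "n < length xs" using Suc by linarith
        ultimately show False using False nth_mem by blast
      qed
    qed
    then have "alt_path A Q F S (xs @ [v])"
      using alt_path_snoc False out(3) xs by auto
    then show ?thesis using xs(3) ne by (intro exI[of _ "xs @ [v]"]) auto
  qed
next
  case (matched u v)
  then obtain xs where xs: "alt_path A Q F S xs" "last xs = u" "odd (length xs - 1)" by auto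
  have ne: "xs \<noteq> []" using xs by (simp add: alt_path_def)
  show ?case
  proof (cases "v \<in> set xs")
    case True
    then obtain i where i: "i < length xs" "v = xs ! i" by (auto simp: in_set_conv_nth)
    have "even i"
      using alt_path_isl[OF xs(1) i(1)] alt_path_isl[OF xs(1), of "length xs - 1"]
        adjE_isl[OF matched(3)] xs(2,3) ne i(2) by (auto simp: last_conv_nth)
    then show ?thesis
      using alt_path_take[OF xs(1) i(1)] i by (intro exI[of _ "take (Suc i) xs"]) auto
  next
    case False
    then have "alt_path A Q F S (xs @ [v])"
      using alt_path_snoc matched(3) adjE_S_F xs by auto
    then show ?thesis using xs(3) ne by (intro exI[of _ "xs @ [v]"]) auto
  qed
qed

lemma ev_iff: "ev v \<longleftrightarrow> (\<exists>xs. alt_path A Q F S xs \<and> last xs = v \<and> even (length xs - 1))"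
proof
  assume "\<exists>xs. alt_path A Q F S xs \<and> last xs = v \<and> even (length xs - 1)"
  then obtain xs where xs: "alt_path A Q F S xs" "last xs = v" "even (length xs - 1)" by auto
  then have "xs \<noteq> []" by (simp add: alt_path_def)
  then show "ev v" using alt_path_nth[OF xs(1), of "length xs - 1"] xs by (simp add: last_conv_nth)
qed (rule alt_path_reaches)

lemma od_iff: "od v \<longleftrightarrow> (\<exists>xs. alt_path A Q F S xs \<and> last xs = v \<and> odd (length xs - 1))"
proof
  assume "\<exists>xs. alt_path A Q F S xs \<and> last xs = v \<and> odd (length xs - 1)"
  then obtain xs where xs: "alt_path A Q F S xs" "last xs = v" "odd (length xs - 1)" by auto
  then have "xs \<noteq> []" by (simp add: alt_path_def)
  then show "od v" using alt_path_nth[OF xs(1), of "length xs - 1"] xs by (simp add: last_conv_nth)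
qed (rule alt_path_reaches)

text \<open>Even posts and odd applicants are reached from an unmatched post; the alternating walk
  read backwards is an augmenting walk.\<close>

lemma ev_Inr: "ev v \<Longrightarrow> v = Inr q \<Longrightarrow> q \<notin> Range S \<or> (\<exists>a qs. (a,q) \<in> S \<and> augmenting F S a qs)"
  and od_Inl: "od v \<Longrightarrow> v = Inl a \<Longrightarrow> \<exists>qs. augmenting F S a qs"
proof (induction arbitrary: q and a rule: alt_even_alt_odd.inducts)
  case (free v)
  then show ?case by auto
next
  case (out u v)
  then obtain q where q: "u = Inr q" "(a,q) \<in> F" by (cases u) auto
  then show ?case
    using out(2)[of q] augmenting.last[of a q F S] augmenting_extend[of F S _ _ q a] by blast
next
  case (matched u v)
  then show ?case by (cases u) auto
qed

text \<open>Without augmenting paths this is a vertex cover of the size of \<open>S\<close> (Koenig). Comparing the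
  covers for both sides \<open>W\<close> pins down what every maximum matching does.\<close>
definition cover where
  "cover W = {v. od v} \<union> (W \<inter> (V - {v. ev v} - {v. od v}))"

section \<open>Koenig covers in the absence of augmenting walks\<close>

context
  assumes no_aug: "\<forall>a qs. a \<notin> Domain S \<longrightarrow> \<not> augmenting F S a qs"
begin

text \<open>Even applicants and odd posts are reached from an unmatched applicant, and an augmenting
  walk would extend backwards to it, against \<open>no_aug\<close>. Together with
  \<open>ev_Inr\<close> and \<open>od_Inl\<close> this separates even from odd.\<close>

lemma ev_Inl: "ev v \<Longrightarrow> v = Inl a \<Longrightarrow> \<not> augmenting F S a qs"
  and od_Inr: "od v \<Longrightarrow> v = Inr q \<Longrightarrow> q \<in> Range S \<and> (\<forall>a qs. (a,q) \<in> S \<longrightarrow> \<not> augmenting F S a qs)"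
proof (induction arbitrary: a qs and q rule: alt_even_alt_odd.inducts)
  case (free v)
  then show ?case using no_aug by auto
next
  case (out u v)
  then obtain a where a: "u = Inl a" "(a,q) \<in> F" by (cases u) auto
  then show ?case
    using out(2)[of a] augmenting.last[of a q F S] augmenting_extend[of F S _ _ q a] by blast
next
  case (matched u v)
  then show ?case by (cases u) auto
qed

lemma not_ev_od: "ev v \<Longrightarrow> \<not> od v"
proof (cases v)
  case (Inl a)
  then show "ev v \<Longrightarrow> \<not> od v" using ev_Inl[of v a] od_Inl[of v a] by blast
next
  case (Inr q)
  then show "ev v \<Longrightarrow> \<not> od v" using ev_Inr[of v q] od_Inr[of v q] by blast
qed

lemma matched_if_not_ev: "v \<in> V \<Longrightarrow> \<not> ev v \<Longrightarrow> v \<in> verts S"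
  using free by blast

lemma finite_cover: "W \<in> {range Inl, range Inr} \<Longrightarrow> finite (cover W)"
proof -
  have "cover W \<subseteq> V" using od_V by (auto simp: cover_def)
  then show ?thesis using finA finQ by (meson finite_UnI finite_imageI finite_subset)
qed

lemma cover_verts: "cover W \<subseteq> verts S"
proof
  fix v assume "v \<in> cover W"
  then have "v \<in> V" "\<not> ev v" using not_ev_od od_V unfolding cover_def by blast+
  then show "v \<in> verts S" by (rule matched_if_not_ev)
qed

text \<open>A neighbour of an even vertex is odd. An edge without even or odd endpoint joins two
  unreachable vertices, one of which lies in \<open>W\<close>.\<close>

lemma cover_edge:
  assumes "W \<in> {range Inl, range Inr}" "(a,q) \<in> F"
  shows "Inl a \<in> cover W \<or> Inr q \<in> cover W"
proof -
  have "Inl a \<in> V" "Inr q \<in> V" using assms(2) F by auto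
  moreover have "ev (Inl a) \<Longrightarrow> od (Inr q)" "ev (Inr q) \<Longrightarrow> od (Inl a)"
    using assms(2) by (auto intro: out)
  ultimately show ?thesis using assms(1) by (auto simp: cover_def)
qed

text \<open>An edge of \<open>S\<close> joins an even to an odd vertex or two unreachable ones, and
  in the latter case only one end lies on the side \<open>W\<close>.\<close>

lemma cover_S:
  assumes "W \<in> {range Inl, range Inr}" "(a,q) \<in> S"
  shows "(Inl a \<in> cover W) \<noteq> (Inr q \<in> cover W)"
proof -
  have "od (Inl a) \<longleftrightarrow> ev (Inr q)" "od (Inr q) \<longleftrightarrow> ev (Inl a)"
    using assms(2) SF by (meson out matched adjE_simps(1,2) subsetD)+
  moreover have "Inl a \<in> cover W \<or> Inr q \<in> cover W" using cover_edge assms SF by blast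
  moreover have "\<not> (Inl a \<in> W \<and> Inr q \<in> W)" using assms(1) by auto
  ultimately show ?thesis
    using not_ev_od[of "Inl a"] not_ev_od[of "Inr q"] unfolding cover_def by blast
qed

lemma card_cover: "W \<in> {range Inl, range Inr} \<Longrightarrow> card (cover W) = card S"
  by (intro card_eq_cover[OF m finS cover_verts, symmetric] cover_S)

text \<open>One direction of Berge's theorem: a cover of size \<open>card S\<close> bounds every
  matching.\<close>

lemma no_augmenting_imp_max: "max_matching F S"
  unfolding max_matching_def
proof (intro conjI m allI impI)
  fix N assume N: "matching F N"
  let ?W = "range Inl"
  have "card N \<le> card (cover ?W)"
    using finite_subset[OF matching_subset[OF N] finF] finite_cover[of ?W] cover_edge[of ?W]
      matching_subset[OF N]
    by (intro card_le_cover(1)[OF N]) auto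
  then show "card N \<le> card S" using card_cover by simp
qed

text \<open>Forward, a maximum matching is tight on both covers, and together they contain all
  vertices that are not even. Conversely, tightness on the cover for \<open>range Inl\<close>
  already fixes the size.\<close>

lemma max_matching_iff_cover:
  assumes N: "matching F N"
  shows "max_matching F N \<longleftrightarrow> V - {v. ev v} \<subseteq> verts N \<and>
    (\<forall>(a,q)\<in>N. (od (Inl a) \<longrightarrow> ev (Inr q)) \<and> (od (Inr q) \<longrightarrow> ev (Inl a)))"
    (is "_ \<longleftrightarrow> ?rhs")
proof
  have fN: "finite N" using finF matching_subset[OF N] by (rule finite_subset[rotated])
  have cov: "(a,q) \<in> N \<Longrightarrow> Inl a \<in> cover W \<or> Inr q \<in> cover W"
    if "W \<in> {range Inl, range Inr}" for a q W
    using cover_edge that matching_subset[OF N] by blast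
  {
    assume "max_matching F N"
    then have "card S \<le> card N" using m by (simp add: max_matching_def)
    then have 1: "cover W \<subseteq> verts N"
      and 2: "(a,q) \<in> N \<Longrightarrow> \<not> (Inl a \<in> cover W \<and> Inr q \<in> cover W)"
      if "W \<in> {range Inl, range Inr}" for W a q
      using card_le_cover(2,3)[OF N fN finite_cover cov] card_cover that by auto
    have "V - {v. ev v} \<subseteq> cover (range Inl) \<union> cover (range Inr)"
      by (auto simp: cover_def)
    then have "V - {v. ev v} \<subseteq> verts N" using 1 by blast
    \<comment> \<open>An edge joining an odd vertex to an odd or unreachable one would have both
      ends in one of the covers.\<close>
    moreover have "(od (Inl a) \<longrightarrow> ev (Inr q)) \<and> (od (Inr q) \<longrightarrow> ev (Inl a))"
      if aq: "(a,q) \<in> N" for a q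
    proof -
      have "a \<in> A" "q \<in> Q" using aq matching_subset[OF N] F by auto
      then show ?thesis
        using 2[of "range Inl", OF _ aq] 2[of "range Inr", OF _ aq] by (auto simp: cover_def)
    qed
    ultimately show ?rhs by blast
  }
  assume r: ?rhs
  have "cover (range Inl) \<subseteq> verts N"
  proof
    fix v assume "v \<in> cover (range Inl)"
    then have "v \<in> V - {v. ev v}" using not_ev_od od_V unfolding cover_def by blast
    then show "v \<in> verts N" using r by blast
  qed
  moreover have "(Inl a \<in> cover (range Inl)) \<noteq> (Inr q \<in> cover (range Inl))"
    if aq: "(a,q) \<in> N" for a q
  proof -
    have "Inl a \<in> cover (range Inl) \<or> Inr q \<in> cover (range Inl)" using cov aq by blast
    moreover have "od (Inr q) \<Longrightarrow> ev (Inl a)" using r aq by blast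
    moreover have "Inr q \<in> cover (range Inl) \<Longrightarrow> od (Inr q)" by (auto simp: cover_def)
    moreover have "ev (Inl a) \<Longrightarrow> Inl a \<notin> cover (range Inl)"
      using not_ev_od unfolding cover_def by blast
    ultimately show ?thesis by blast
  qed
  ultimately have "card N = card (cover (range Inl))"
    using card_eq_cover[OF N fN] by blast
  also have "\<dots> = card S" using card_cover by simp
  finally show "max_matching F N"
    using no_augmenting_imp_max N by (simp add: max_matching_def)
qed

end

lemma augmenting_if_not_max:
  assumes "\<not> max_matching F S"
  shows "\<exists>K. matching F K \<and> card K = Suc (card S) \<and> verts S \<subseteq> verts K"
proof -
  obtain a qs where "a \<notin> Domain S" "augmenting F S a qs"
    using no_augmenting_imp_max assms by blast
  then show ?thesis using augment[OF _ m finS, of a qs] by auto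
qed

lemma max_imp_no_augmenting:
  assumes "max_matching F S" "a \<notin> Domain S"
  shows "\<not> augmenting F S a qs"
proof
  assume "augmenting F S a qs"
  then obtain K where "matching F K" "card K = Suc (card S)"
    using augment[OF _ m finS assms(2)] by blast
  then show False using assms(1) unfolding max_matching_def by fastforce
qed

end

text \<open>The sets come from the one matching \<open>some_max F\<close>, yet the criterion applies
  to every matching \<open>N\<close>. Avoiding \<open>bad_edges\<close> is what tightness on the
  covers says about single edges.\<close>

lemma max_matching_iff:
  assumes "finite A" "finite Q" "F \<subseteq> A \<times> Q" "matching F N"
  shows "max_matching F N \<longleftrightarrow> odd_set A Q F \<union> unr_set A Q F \<subseteq> verts N \<and> N \<inter> bad_edges A Q F = {}"
proof -
  have "finite F" using assms(1-3) by (meson finite_SigmaI finite_subset)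
  then have mx: "max_matching F (some_max F)" by (rule max_matching_some_max)
  interpret bipartite_matching A Q F "some_max F"
    using assms(1-3) mx by unfold_locales (simp_all add: max_matching_def)
  have na: "\<forall>a qs. a \<notin> Domain (some_max F) \<longrightarrow> \<not> augmenting F (some_max F) a qs"
    using max_imp_no_augmenting[OF mx] by blast
  have e: "even_set A Q F = {v. ev v}" and o: "odd_set A Q F = {v. od v}"
    by (simp_all add: even_set_def odd_set_def ev_iff od_iff)
  have ds: "od v \<Longrightarrow> v \<in> V \<and> \<not> ev v" for v
    using not_ev_od[OF na] od_V by blast
  have ou: "odd_set A Q F \<union> unr_set A Q F = V - {v. ev v}"
    unfolding unr_set_def e o using ds by auto
  have bad: "(a,q) \<in> bad_edges A Q F \<longleftrightarrow> \<not> ((od (Inl a) \<longrightarrow> ev (Inr q)) \<and> (od (Inr q) \<longrightarrow> ev (Inl a)))"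
    if "(a,q) \<in> N" for a q
  proof -
    have "(a,q) \<in> F" "Inl a \<in> V" "Inr q \<in> V"
      using that assms(3) matching_subset[OF assms(4)] by auto
    then show ?thesis unfolding bad_edges_def ou by (simp add: o)
  qed
  have "N \<inter> bad_edges A Q F = {} \<longleftrightarrow> (\<forall>(a,q)\<in>N. (a,q) \<notin> bad_edges A Q F)"
    by auto
  also have "\<dots> \<longleftrightarrow> (\<forall>(a,q)\<in>N. (od (Inl a) \<longrightarrow> ev (Inr q)) \<and> (od (Inr q) \<longrightarrow> ev (Inl a)))"
    by (intro ball_cong refl) (clarsimp simp: bad)
  finally show ?thesis
    unfolding ou max_matching_iff_cover[OF na assms(4)] by simp
qed

lemma unmatched_imp_even:
  assumes "finite A" "finite Q" "F \<subseteq> A \<times> Q" "max_matching F N"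
    "v \<in> Inl ` A \<union> Inr ` Q" "v \<notin> verts N"
  shows "v \<in> even_set A Q F"
proof -
  have "matching F N" using assms(4) by (simp add: max_matching_def)
  then have "odd_set A Q F \<union> unr_set A Q F \<subseteq> verts N"
    using max_matching_iff[OF assms(1-3)] assms(4) by blast
  then show ?thesis using assms(5,6) unfolding unr_set_def by blast
qed

section \<open>The graphs of Irving et al.'s algorithm\<close>

definition upto_rank :: "('a \<Rightarrow> 'q \<Rightarrow> nat) \<Rightarrow> nat \<Rightarrow> ('a \<times> 'q) set \<Rightarrow> ('a \<times> 'q) set" where
  "upto_rank \<rho> i N = {(a,q) \<in> N. \<rho> a q \<le> i}"

lemma upto_rank_iff [simp]: "(a,q) \<in> upto_rank \<rho> i N \<longleftrightarrow> (a,q) \<in> N \<and> \<rho> a q \<le> i"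
  by (simp add: upto_rank_def)

lemma upto_rank_subset: "upto_rank \<rho> i N \<subseteq> N"
  by (auto simp: upto_rank_def)

locale ranked_graph =
  fixes A :: "'a set" and Q :: "'q set" and F :: "('a \<times> 'q) set"
    and \<rho> :: "'a \<Rightarrow> 'q \<Rightarrow> nat" and r :: nat
  assumes finA: "finite A" and finQ: "finite Q" and F: "F \<subseteq> A \<times> Q"
    and rank: "(a,q) \<in> F \<Longrightarrow> 1 \<le> \<rho> a q \<and> \<rho> a q \<le> r + 1"
begin

text \<open>Indices are shifted by one: \<open>H k\<close> is the graph of level k + 1, with edges
  of rank at most k + 1, and \<open>D k\<close> collects the odd and unreachable vertices of levels
  1 to k.\<close>

abbreviation "H k \<equiv> fst (irving_st A Q F \<rho> k)"
abbreviation "D k \<equiv> snd (irving_st A Q F \<rho> k)"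
abbreviation "OU k \<equiv> odd_set A Q (H k) \<union> unr_set A Q (H k)"

lemma H_Suc: "H (Suc k) = (H k - bad_edges A Q (H k)) \<union>
    {(a,q) \<in> rank_edges F \<rho> (k + 2). Inl a \<notin> D (Suc k) \<and> Inr q \<notin> D (Suc k)}"
  and D_Suc: "D (Suc k) = D k \<union> OU k"
  by (auto simp: Let_def)

declare irving_st.simps(2) [simp del]

lemma D_eq: "D k = (\<Union>j<k. OU j)"
  by (induction k) (simp_all add: D_Suc lessThan_Suc Un_commute)

lemma finF: "finite F" using finA finQ F by (meson finite_SigmaI finite_subset)

lemma H_subset: "H k \<subseteq> upto_rank \<rho> (k + 1) F"
proof (induction k)
  case 0
  then show ?case by (auto simp: rank_edges_def)
next
  case (Suc k)
  then show ?case unfolding H_Suc by (fastforce simp: rank_edges_def)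
qed

lemma H_AQ: "H k \<subseteq> A \<times> Q"
  using H_subset[of k] upto_rank_subset[of \<rho> "k + 1" F] F by blast

text \<open>Every later step deletes edges or adds edges of rank above j + 1, so no edge of low rank
  is new.\<close>

lemma H_mono: "j \<le> k \<Longrightarrow> upto_rank \<rho> (j + 1) (H k) \<subseteq> H j"
proof (induction k rule: dec_induct)
  case base
  then show ?case by (rule upto_rank_subset)
next
  case (step k)
  have "upto_rank \<rho> (j + 1) (H (Suc k)) \<subseteq> upto_rank \<rho> (j + 1) (H k)"
    unfolding H_Suc using step(1) by (auto simp: rank_edges_def)
  then show ?case using step.IH by blast
qed

text \<open>A deleted edge cannot return, since its rank is at most j + 1 and later steps only add
  higher ranks.\<close>

lemma H_Int_bad_edges: "j < k \<Longrightarrow> H k \<inter> bad_edges A Q (H j) = {}"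
proof (intro equals0I, clarify)
  fix a q assume jk: "j < k" and aq: "(a,q) \<in> H k" "(a,q) \<in> bad_edges A Q (H j)"
  then have "(a,q) \<in> H j" by (auto simp: bad_edges_def)
  then have "\<rho> a q \<le> j + 1" using H_subset[of j] by auto
  moreover have "(a,q) \<in> H (Suc j)"
    using H_mono[of "Suc j" k] jk aq(1) \<open>\<rho> a q \<le> j + 1\<close> by auto
  ultimately show False using aq(2) by (auto simp: H_Suc rank_edges_def)
qed

text \<open>An edge of rank i + 2 enters at the step from \<open>H i\<close> to
  \<open>H (Suc i)\<close>, whose filter \<open>D (Suc i)\<close> contains \<open>OU j\<close>
  whenever j \<le> i.\<close>

lemma rank_le_if_OU:
  assumes "j < k" "(a,q) \<in> H k" "Inl a \<in> OU j \<or> Inr q \<in> OU j"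
  shows "\<rho> a q \<le> j + 1"
proof (rule ccontr)
  assume "\<not> \<rho> a q \<le> j + 1"
  then obtain i where i: "\<rho> a q = i + 2" "j \<le> i"
    by (intro that[of "\<rho> a q - 2"]) auto
  have "i < k" using H_subset[of k] assms(2) i by auto
  then have "(a,q) \<in> H (Suc i)" using H_mono[of "Suc i" k] assms(2) i by auto
  moreover have "(a,q) \<notin> H i" using H_subset[of i] i by auto
  ultimately have "Inl a \<notin> D (Suc i)" "Inr q \<notin> D (Suc i)" unfolding H_Suc by auto
  then show False using assms(3) i(2) unfolding D_eq by (auto simp: less_Suc_eq_le)
qed

section \<open>Rank-maximal matchings\<close>

lemma nth_signature: "j \<le> r \<Longrightarrow> signature \<rho> r N ! j = card {(a,q) \<in> N. \<rho> a q = j + 1}"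
  by (simp add: signature_def nth_append del: upt_Suc)

lemma length_signature: "length (signature \<rho> r N) = r + 1"
  by (simp add: signature_def del: upt_Suc)

lemma card_upto_rank_Suc:
  assumes "finite N"
  shows "card (upto_rank \<rho> (Suc i) N) = card (upto_rank \<rho> i N) + card {(a,q) \<in> N. \<rho> a q = Suc i}"
proof -
  have "upto_rank \<rho> (Suc i) N = upto_rank \<rho> i N \<union> {(a,q) \<in> N. \<rho> a q = Suc i}" by auto
  moreover have "finite (upto_rank \<rho> i N)" "finite {(a,q) \<in> N. \<rho> a q = Suc i}"
    using assms by (auto intro: finite_subset[of _ N])
  ultimately show ?thesis by (simp add: card_Un_disjoint disjoint_iff)
qed

lemma card_upto_rank_0: "N \<subseteq> F \<Longrightarrow> card (upto_rank \<rho> 0 N) = 0"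
  using rank by (fastforce simp: upto_rank_def card_eq_0_iff)

text \<open>Entries of the signature are differences of the cumulative counts, so both sequences
  first differ at the same position.\<close>

lemma lex_gt_signature_if:
  assumes "matching F N" "matching F K" "k \<le> r"
    and "\<And>j. j < k \<Longrightarrow> card (upto_rank \<rho> (j + 1) K) = card (upto_rank \<rho> (j + 1) N)"
    and "card (upto_rank \<rho> (k + 1) N) < card (upto_rank \<rho> (k + 1) K)"
  shows "lex_gt (signature \<rho> r K) (signature \<rho> r N)"
proof -
  have s: "N \<subseteq> F" "K \<subseteq> F" using assms by (auto dest: matching_subset)
  then have f: "finite N" "finite K" using finF by (auto intro: finite_subset)
  \<comment> \<open>Extends the equality to index 0, where both counts vanish because ranks start at
    1.\<close>
  have e: "card (upto_rank \<rho> j K) = card (upto_rank \<rho> j N)" if "j \<le> k" for j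
    using assms(4)[of "j - 1"] that s card_upto_rank_0 by (cases j) auto
  have "signature \<rho> r K ! j = signature \<rho> r N ! j" if "j < k" for j
    using e[of j] e[of "Suc j"] that assms(3) card_upto_rank_Suc[OF f(1), of j]
      card_upto_rank_Suc[OF f(2), of j] by (simp add: nth_signature)
  moreover have "signature \<rho> r N ! k < signature \<rho> r K ! k"
    using e[of k] assms(3,5) card_upto_rank_Suc[OF f(1), of k]
      card_upto_rank_Suc[OF f(2), of k] by (simp add: nth_signature)
  ultimately show ?thesis
    unfolding lex_gt_def length_signature using assms(3) by (intro exI[of _ k]) auto
qed

text \<open>Strong induction, since an improvement at level k + 1 must be compared with
  \<open>M\<close> at all lower levels at the same time.\<close>

lemma rank_maximal_imp_max_matching_upto:
  assumes M: "rank_maximal F \<rho> r M"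
  shows "k \<le> r \<Longrightarrow> max_matching (H k) (upto_rank \<rho> (k + 1) M)"
proof (induction k rule: less_induct)
  case (less k)
  let ?N = "\<lambda>j. upto_rank \<rho> (j + 1) M"
  have mM: "matching F M" using M by (simp add: rank_maximal_def)
  have MF: "M \<subseteq> F" using mM by (rule matching_subset)
  have IH: "max_matching (H j) (?N j)" if "j < k" for j
    using less that by simp
  have mIH: "matching (H j) (?N j)" if "j < k" for j
    using IH[OF that] by (simp add: max_matching_def)
  have IH': "OU j \<subseteq> verts (?N j)" "?N j \<inter> bad_edges A Q (H j) = {}" if "j < k" for j
    using max_matching_iff[OF finA finQ H_AQ mIH[OF that]] IH[OF that] by blast+
  have NH: "?N k \<subseteq> H k"
  proof (cases k)
    case 0
    then show ?thesis using MF rank by (fastforce simp: rank_edges_def)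
  next
    case (Suc i)
    have "(a,q) \<in> H k" if aq: "(a,q) \<in> ?N k" for a q
    proof (cases "\<rho> a q \<le> i + 1")
      case True
      then have "(a,q) \<in> ?N i" using aq by simp
      then show ?thesis using mIH[of i] IH'(2)[of i] matching_subset unfolding Suc H_Suc by blast
    next
      case False
      then have r: "\<rho> a q = i + 2" using aq Suc by simp
      \<comment> \<open>\<open>OU j\<close> is matched by edges of \<open>M\<close> of rank at most
        j + 1, and \<open>M\<close> has only one edge at each vertex.\<close>
      have "Inl a \<notin> OU j \<and> Inr q \<notin> OU j" if j: "j \<le> i" for j
      proof (rule ccontr)
        assume "\<not> ?thesis"
        moreover have "OU j \<subseteq> verts (?N j)" using IH'(1)[of j] j Suc by (simp only: less_Suc_eq_le)
        ultimately have "Inl a \<in> verts (?N j) \<or> Inr q \<in> verts (?N j)" by blast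
        moreover have "(a,q) \<in> M" using aq by simp
        ultimately have "\<rho> a q \<le> j + 1"
          using matching_eq1[OF mM, of a q] matching_eq2[OF mM, of a q]
          unfolding verts_iff upto_rank_iff by blast
        then show False using r j by simp
      qed
      then have "Inl a \<notin> D k" "Inr q \<notin> D k"
        unfolding D_eq Suc by (auto simp: less_Suc_eq_le)
      then show ?thesis using r aq MF unfolding Suc H_Suc by (auto simp: rank_edges_def)
    qed
    then show ?thesis by auto
  qed
  then have mN: "matching (H k) (?N k)"
    by (rule matching_mono[OF mM upto_rank_subset])
  interpret bipartite_matching A Q "H k" "?N k"
    using finA finQ H_AQ mN by unfold_locales
  show ?case
  proof (rule ccontr)
    assume "\<not> ?case"
    \<comment> \<open>\<open>K\<close> still covers all vertices matched by \<open>?N k\<close>, in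
      particular every \<open>OU j\<close> with j < k.\<close>
    then obtain K where K: "matching (H k) K" "card K = Suc (card (?N k))" "verts (?N k) \<subseteq> verts K"
      using augmenting_if_not_max by blast
    have KH: "K \<subseteq> H k" using K(1) by (rule matching_subset)
    have KF: "K \<subseteq> F" using KH H_subset[of k] upto_rank_subset by blast
    have mK: "matching F K" by (rule matching_mono[OF K(1) order_refl KF])
    have "upto_rank \<rho> (k + 1) K = K" using KH H_subset[of k] by auto
    then have gt: "card (?N k) < card (upto_rank \<rho> (k + 1) K)" using K(2) by simp
    have eq: "card (upto_rank \<rho> (j + 1) K) = card (?N j)" if j: "j < k" for j
    proof -
      let ?K = "upto_rank \<rho> (j + 1) K"
      have sub: "?K \<subseteq> H j" using H_mono[of j k] j KH by fastforce
      have mj: "matching (H j) ?K" by (rule matching_mono[OF K(1) upto_rank_subset sub])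
      have NN: "verts (?N j) \<subseteq> verts (?N k)" using j by (force simp: verts_def)
      \<comment> \<open>The edge of \<open>K\<close> at such a vertex may be new, but
        \<open>rank_le_if_OU\<close> keeps its rank at most j + 1, so it survives
        truncation.\<close>
      have "OU j \<subseteq> verts ?K"
      proof
        fix v assume v: "v \<in> OU j"
        then have "v \<in> verts K" using IH'(1)[OF j] NN K(3) by blast
        then obtain a q where aq: "(a,q) \<in> K" "v = Inl a \<or> v = Inr q"
          by (cases v) auto
        then have "\<rho> a q \<le> j + 1" using rank_le_if_OU[OF j] KH v by blast
        then have "(a,q) \<in> ?K" using aq by simp
        then show "v \<in> verts ?K" using aq(2) by (auto simp only: verts_iff)
      qed
      moreover have "?K \<inter> bad_edges A Q (H j) = {}"
        using H_Int_bad_edges[OF j] KH upto_rank_subset by blast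
      ultimately have "max_matching (H j) ?K"
        using max_matching_iff[OF finA finQ H_AQ mj] by blast
      then show ?thesis using IH[OF j] unfolding max_matching_def by (meson le_antisym)
    qed
    have "lex_gt (signature \<rho> r K) (signature \<rho> r M)"
      using lex_gt_signature_if[OF mM mK less.prems eq gt] .
    then show False using M mK by (auto simp: rank_maximal_def)
  qed
qed

text \<open>No rank exceeds r + 1, so at the last level the truncation is \<open>M\<close> itself,
  and the criterion excludes the edges deleted last.\<close>

lemma rank_maximal_subset_reduced:
  assumes M: "rank_maximal F \<rho> r M"
  shows "M \<subseteq> reduced A Q F \<rho> r"
proof -
  have "M \<subseteq> F" using M by (auto simp: rank_maximal_def dest: matching_subset)
  then have "upto_rank \<rho> (r + 1) M = M" using rank by auto
  then have "max_matching (H r) M" using rank_maximal_imp_max_matching_upto[OF M, of r] by simp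
  moreover from this have m: "matching (H r) M" by (simp add: max_matching_def)
  ultimately have "M \<inter> bad_edges A Q (H r) = {}"
    using max_matching_iff[OF finA finQ H_AQ m] by blast
  then show ?thesis using matching_subset[OF m] by (auto simp: reduced_def Gi_def)
qed

text \<open>A post free in \<open>M\<close> is free in each truncation of \<open>M\<close>, a
  maximum matching of the corresponding graph. This provides the evenness required of a
  sink.\<close>

lemma unmatched_imp_even_Gi:
  assumes M: "rank_maximal F \<rho> r M" and "q \<in> Q" "q \<notin> Range M" "i \<in> {1..r + 1}"
  shows "Inr q \<in> even_set A Q (Gi A Q F \<rho> i)"
proof -
  have "max_matching (H (i - 1)) (upto_rank \<rho> (i - 1 + 1) M)"
    using assms(4) by (intro rank_maximal_imp_max_matching_upto[OF M]) auto
  then show ?thesis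
    unfolding Gi_def using assms(2,3) by (intro unmatched_imp_even[OF finA finQ H_AQ]) auto
qed

end

section \<open>Decomposition of a partial injection into paths and cycles\<close>

definition linked :: "('q \<times> 'q) set \<Rightarrow> 'q list \<Rightarrow> bool" where
  "linked R xs \<longleftrightarrow> xs \<noteq> [] \<and> distinct xs \<and> (\<forall>i. Suc i < length xs \<longrightarrow> (xs ! i, xs ! Suc i) \<in> R)"

definition path_component :: "('q \<times> 'q) set \<Rightarrow> 'q list \<Rightarrow> bool" where
  "path_component R xs \<longleftrightarrow> linked R xs \<and> hd xs \<notin> Range R \<and> last xs \<notin> Domain R"

definition cycle_component :: "('q \<times> 'q) set \<Rightarrow> 'q list \<Rightarrow> bool" where
  "cycle_component R xs \<longleftrightarrow> linked R xs \<and> (last xs, hd xs) \<in> R"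

definition pairwise_disjoint :: "'q list set \<Rightarrow> 'q list set \<Rightarrow> bool" where
  "pairwise_disjoint Ps Cs \<longleftrightarrow>
    (\<forall>xs \<in> Ps. \<forall>ys \<in> Ps. xs \<noteq> ys \<longrightarrow> set xs \<inter> set ys = {}) \<and>
    (\<forall>xs \<in> Cs. \<forall>ys \<in> Cs. xs \<noteq> ys \<longrightarrow> set xs \<inter> set ys = {}) \<and>
    (\<forall>xs \<in> Ps. \<forall>ys \<in> Cs. set xs \<inter> set ys = {})"

lemma moves_path: "moves {xs} {} = (\<lambda>i. (xs ! i, xs ! Suc i)) ` {..<length xs - 1}"
  by (force simp: moves_def)

lemma moves_cycle: "moves {} {xs} = (\<lambda>i. (xs ! i, xs ! (Suc i mod length xs))) ` {..<length xs}"
  by (auto simp: moves_def)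

lemma moves_insert:
  "moves (insert xs Ps) Cs = moves {xs} {} \<union> moves Ps Cs"
  "moves Ps (insert xs Cs) = moves {} {xs} \<union> moves Ps Cs"
  unfolding moves_def by blast+

lemma moves_subset_set:
  "moves {xs} {} \<subseteq> set xs \<times> set xs" "moves {} {xs} \<subseteq> set xs \<times> set xs"
proof -
  show "moves {xs} {} \<subseteq> set xs \<times> set xs" by (auto simp: moves_path)
  have "xs ! (Suc i mod length xs) \<in> set xs" if "i < length xs" for i
    using that by (intro nth_mem mod_less_divisor) linarith
  then show "moves {} {xs} \<subseteq> set xs \<times> set xs" by (auto simp: moves_cycle)
qed

lemma cycle_component_nth:
  assumes "cycle_component R xs" "i < length xs"
  shows "(xs ! i, xs ! (Suc i mod length xs)) \<in> R"
proof (cases "Suc i < length xs")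
  case True
  then show ?thesis using assms by (simp add: cycle_component_def linked_def)
next
  case False
  then have i: "i = length xs - 1" "Suc i = length xs" using assms(2) by auto
  have "xs \<noteq> []" using assms(2) by auto
  then show ?thesis using assms(1) i unfolding cycle_component_def
    by (metis hd_conv_nth last_conv_nth mod_self)
qed

lemma moves_subset:
  "path_component R xs \<Longrightarrow> moves {xs} {} \<subseteq> R"
  "cycle_component R xs \<Longrightarrow> moves {} {xs} \<subseteq> R"
  using cycle_component_nth[of R xs] unfolding moves_cycle moves_path path_component_def linked_def
  by auto

text \<open>No edge of \<open>R\<close> leaves or enters \<open>X\<close>, and \<open>T\<close>
  consists of the edges inside. This common property of path and cycle components supports both
  their removal and the exchange along them.\<close>

definition closed_under :: "('q \<times> 'q) set \<Rightarrow> ('q \<times> 'q) set \<Rightarrow> 'q set \<Rightarrow> bool" where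
  "closed_under R T X \<longleftrightarrow> T \<subseteq> R \<and> T \<subseteq> X \<times> X \<and> (\<forall>(p,q)\<in>R. p \<in> X \<or> q \<in> X \<longrightarrow> (p,q) \<in> T)"

locale partial_injection =
  fixes R :: "('q \<times> 'q) set"
  assumes finR: "finite R"
    and functional: "(p,q) \<in> R \<Longrightarrow> (p,q') \<in> R \<Longrightarrow> q = q'"
    and injective: "(p,q) \<in> R \<Longrightarrow> (p',q) \<in> R \<Longrightarrow> p = p'"
begin

lemma linked_succ:
  assumes "linked R xs" "i < length xs" "(xs ! i, q) \<in> R"
  shows "Suc i < length xs \<and> q = xs ! Suc i \<or> i = length xs - 1 \<and> xs ! i = last xs"
proof (cases "Suc i < length xs")
  case True
  then show ?thesis using assms functional unfolding linked_def by blast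
next
  case False
  then have "i = length xs - 1" using assms(2) by simp
  then show ?thesis using assms by (auto simp: last_conv_nth linked_def)
qed

lemma linked_pred:
  assumes "linked R xs" "i < length xs" "(p, xs ! i) \<in> R"
  shows "(\<exists>j. i = Suc j \<and> p = xs ! j) \<or> i = 0 \<and> xs ! i = hd xs"
proof (cases i)
  case 0
  then show ?thesis using assms by (auto simp: hd_conv_nth linked_def)
next
  case (Suc j)
  then show ?thesis using assms injective unfolding linked_def by blast
qed

lemma path_component_closed:
  assumes "path_component R xs"
  shows "closed_under R (moves {xs} {}) (set xs)"
  unfolding closed_under_def
proof (intro conjI moves_subset(1)[OF assms] moves_subset_set(1), clarify)
  fix p q assume pq: "(p,q) \<in> R" "p \<in> set xs \<or> q \<in> set xs"
  have l: "linked R xs" "hd xs \<notin> Range R" "last xs \<notin> Domain R"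
    using assms by (auto simp: path_component_def)
  have "\<exists>i. Suc i < length xs \<and> p = xs ! i \<and> q = xs ! Suc i"
    using pq(2)
  proof
    assume "p \<in> set xs"
    then obtain i where "i < length xs" "p = xs ! i" by (auto simp: in_set_conv_nth)
    then show ?thesis using linked_succ[OF l(1), of i q] pq(1) l(3) by auto
  next
    assume "q \<in> set xs"
    then obtain i where "i < length xs" "q = xs ! i" by (auto simp: in_set_conv_nth)
    then show ?thesis using linked_pred[OF l(1), of i p] pq(1) l(2) by auto
  qed
  then show "(p,q) \<in> moves {xs} {}" by (force simp: moves_path)
qed

lemma cycle_component_closed:
  assumes "cycle_component R xs"
  shows "closed_under R (moves {} {xs}) (set xs)"
  unfolding closed_under_def
proof (intro conjI moves_subset(2)[OF assms] moves_subset_set(2), clarify)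
  fix p q assume pq: "(p,q) \<in> R" "p \<in> set xs \<or> q \<in> set xs"
  have l: "linked R xs" "(last xs, hd xs) \<in> R"
    using assms by (auto simp: cycle_component_def)
  have ne: "xs \<noteq> []" using l by (simp add: linked_def)
  \<comment> \<open>An edge ending on the cycle starts on it by injectivity. Functionality then
    determines the target, so only the source has to be located.\<close>
  have "p \<in> set xs"
  proof (cases "q \<in> set xs")
    case True
    then obtain i where "i < length xs" "q = xs ! i" by (auto simp: in_set_conv_nth)
    then show ?thesis
      using linked_pred[OF l(1), of i p] pq(1) injective[OF l(2), of p] last_in_set[OF ne] by auto
  qed (use pq in blast)
  then obtain i where i: "i < length xs" "p = xs ! i" by (auto simp: in_set_conv_nth)
  then have "q = xs ! (Suc i mod length xs)"
    using functional pq(1) cycle_component_nth[OF assms i(1)] by blast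
  then show "(p,q) \<in> moves {} {xs}" using i by (auto simp: moves_cycle)
qed

text \<open>Take a longest linked list. An edge leaving its last or entering its first vertex cannot
  prolong it, hence returns to the list, and then closes a cycle.\<close>

lemma component_exists:
  assumes "R \<noteq> {}"
  shows "\<exists>xs. set xs \<subseteq> Field R \<and> (path_component R xs \<or> cycle_component R xs)"
proof -
  let ?P = "\<lambda>xs. linked R xs \<and> set xs \<subseteq> Field R"
  obtain x where "x \<in> Field R" using assms by (auto simp: Field_def)
  then have "?P [x]" by (simp add: linked_def)
  moreover have "length xs < Suc (card (Field R))" if "?P xs" for xs
    using that card_mono[OF finite_Field[OF finR], of "set xs"]
    by (simp add: linked_def distinct_card)
  ultimately obtain xs where xs: "linked R xs" "set xs \<subseteq> Field R"
    and longest: "\<And>ys. ?P ys \<Longrightarrow> length ys \<le> length xs"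
    using ex_has_greatest_nat[of ?P "[x]" length "Suc (card (Field R))"] by blast
  have ne: "xs \<noteq> []" using xs by (simp add: linked_def)
  have "cycle_component R xs" if q: "(last xs, q) \<in> R" for q
  proof -
    have "linked R (xs @ [q])" if "q \<notin> set xs"
      unfolding linked_def
    proof (intro conjI allI impI)
      fix i assume i: "Suc i < length (xs @ [q])"
      show "((xs @ [q]) ! i, (xs @ [q]) ! Suc i) \<in> R"
      proof (cases "Suc i < length xs")
        case True
        then show ?thesis using xs by (simp add: linked_def nth_append)
      next
        case False
        then have "i = length xs - 1" using i by simp
        then show ?thesis using q ne by (simp add: nth_append last_conv_nth)
      qed
    qed (use xs that in \<open>auto simp: linked_def\<close>)
    moreover have "q \<in> Field R" using q by (auto simp: Field_def)
    ultimately have "q \<in> set xs" using longest[of "xs @ [q]"] xs by auto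
    then obtain i where i: "i < length xs" "q = xs ! i" by (auto simp: in_set_conv_nth)
    \<comment> \<open>At any other position \<open>q\<close> would have a predecessor on the list,
      which by injectivity is the last element; then \<open>q\<close> would come after it.\<close>
    have "q = hd xs"
    proof (rule ccontr)
      assume "q \<noteq> hd xs"
      then obtain j where j: "i = Suc j" "last xs = xs ! j"
        using linked_pred[OF xs(1) i(1), of "last xs"] q i(2) by auto
      then have "xs ! (length xs - 1) = xs ! j" using ne by (simp add: last_conv_nth)
      then have "length xs - 1 = j"
        using nth_eq_iff_index_eq[of xs "length xs - 1" j] xs(1) i j(1) by (auto simp: linked_def)
      then show False using i j(1) by simp
    qed
    then show ?thesis using xs q by (simp add: cycle_component_def)
  qed
  \<comment> \<open>An edge into the first vertex turns out to leave the last one, which reduces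
    this case to the previous one.\<close>
  moreover have "\<exists>q. (last xs, q) \<in> R" if p: "(p, hd xs) \<in> R" for p
  proof -
    have "linked R (p # xs)" if "p \<notin> set xs"
      unfolding linked_def
    proof (intro conjI allI impI)
      fix i assume "Suc i < length (p # xs)"
      then show "((p # xs) ! i, (p # xs) ! Suc i) \<in> R"
        using xs p ne by (cases i) (auto simp: linked_def hd_conv_nth)
    qed (use xs that in \<open>auto simp: linked_def\<close>)
    moreover have "p \<in> Field R" using p by (auto simp: Field_def)
    ultimately have "p \<in> set xs" using longest[of "p # xs"] xs by auto
    then obtain i where i: "i < length xs" "p = xs ! i" by (auto simp: in_set_conv_nth)
    have "\<not> (Suc i < length xs \<and> hd xs = xs ! Suc i)"
      using xs(1) ne nth_eq_iff_index_eq[of xs 0 "Suc i"] by (auto simp: linked_def hd_conv_nth)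
    then have "p = last xs" using linked_succ[OF xs(1) i(1), of "hd xs"] p i(2) by auto
    then show ?thesis using p by auto
  qed
  ultimately show ?thesis using xs unfolding path_component_def by blast
qed

end

lemma partial_injection_subset: "partial_injection R \<Longrightarrow> R' \<subseteq> R \<Longrightarrow> partial_injection R'"
  unfolding partial_injection_def by (meson finite_subset subsetD)

text \<open>All edges at \<open>X\<close> are gone from \<open>R - T\<close>, so a list within its
  field avoids \<open>X\<close>. Outside \<open>X\<close> both relations have the same edges, and
  maximality at the ends carries over.\<close>

lemma component_Diff:
  assumes "closed_under R T X" "set zs \<subseteq> Field (R - T)"
  shows "set zs \<inter> X = {}"
    and "path_component (R - T) zs \<Longrightarrow> path_component R zs"
    and "cycle_component (R - T) zs \<Longrightarrow> cycle_component R zs"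
proof -
  show dj: "set zs \<inter> X = {}"
    using assms unfolding closed_under_def Field_def by blast
  have T: "T \<subseteq> X \<times> X" using assms(1) by (simp add: closed_under_def)
  show "path_component R zs" if "path_component (R - T) zs"
  proof -
    from that have zs: "linked (R - T) zs" "hd zs \<notin> Range (R - T)" "last zs \<notin> Domain (R - T)"
      by (simp_all add: path_component_def)
    then have "hd zs \<in> set zs" "last zs \<in> set zs" by (simp_all add: linked_def)
    then have "hd zs \<notin> X" "last zs \<notin> X" using dj by auto
    then show ?thesis using zs T unfolding path_component_def linked_def by blast
  qed
  show "cycle_component R zs" if "cycle_component (R - T) zs"
    using that unfolding cycle_component_def linked_def by blast
qed

text \<open>Components are split off one at a time. The condition on the field keeps them apart: a
  vertex of a removed component has no edges left and could otherwise reappear as a one-element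
  path.\<close>

theorem decomposition:
  assumes "partial_injection R"
  shows "\<exists>Ps Cs. (\<forall>xs\<in>Ps. path_component R xs \<and> set xs \<subseteq> Field R) \<and>
    (\<forall>xs\<in>Cs. cycle_component R xs \<and> set xs \<subseteq> Field R) \<and>
    pairwise_disjoint Ps Cs \<and> moves Ps Cs = R"
proof -
  have "finite R" using assms by (simp add: partial_injection_def)
  then show ?thesis using assms
  proof (induction R rule: finite_psubset_induct)
    case (psubset R)
    interpret partial_injection R by fact
    show ?case
    proof (cases "R = {}")
      case True
      then show ?thesis
        by (intro exI[of _ "{}"]) (simp add: pairwise_disjoint_def moves_def)
    next
      case False
      then obtain xs where xs: "set xs \<subseteq> Field R" "path_component R xs \<or> cycle_component R xs"
        using component_exists by blast
      define T where "T = (if path_component R xs then moves {xs} {} else moves {} {xs})"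
      have closed: "closed_under R T (set xs)"
        using xs(2) path_component_closed[of xs] cycle_component_closed[of xs] unfolding T_def by presburger
      have "xs \<noteq> []" using xs by (auto simp: path_component_def cycle_component_def linked_def)
      then have "hd xs \<in> Field R" "hd xs \<in> set xs" using xs by auto
      \<comment> \<open>The first vertex of \<open>xs\<close> lies on some edge of \<open>R\<close>,
        which closedness puts into \<open>T\<close>; so \<open>R - T\<close> is strictly
        smaller.\<close>
      then have "T \<noteq> {}" using closed unfolding closed_under_def Field_def by blast
      moreover have TR: "T \<subseteq> R" using closed by (simp add: closed_under_def)
      ultimately have "R - T \<subset> R" by blast
      moreover have "partial_injection (R - T)"
        using partial_injection_subset[OF partial_injection_axioms, of "R - T"] by blast
      ultimately obtain Ps Cs where
        P: "\<forall>zs\<in>Ps. path_component (R - T) zs \<and> set zs \<subseteq> Field (R - T)" and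
        C: "\<forall>zs\<in>Cs. cycle_component (R - T) zs \<and> set zs \<subseteq> Field (R - T)" and
        dj: "pairwise_disjoint Ps Cs" and mv: "moves Ps Cs = R - T"
        using psubset.IH[of "R - T"] by metis
      have Fd: "Field (R - T) \<subseteq> Field R" by (rule mono_Field) blast
      have P': "path_component R zs \<and> set zs \<subseteq> Field R" "set zs \<inter> set xs = {}" if "zs \<in> Ps" for zs
        using component_Diff(1,2)[OF closed, of zs] P that Fd by auto
      have C': "cycle_component R zs \<and> set zs \<subseteq> Field R" "set zs \<inter> set xs = {}" if "zs \<in> Cs" for zs
        using component_Diff(1,3)[OF closed, of zs] C that Fd by auto
      show ?thesis
      proof (cases "path_component R xs")
        case True
        have "pairwise_disjoint (insert xs Ps) Cs"
          using dj P'(2) C'(2) unfolding pairwise_disjoint_def by blast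
        moreover have "moves (insert xs Ps) Cs = R"
          using moves_insert(1)[of xs Ps Cs] TR mv True by (auto simp: T_def)
        ultimately show ?thesis
          using P'(1) C'(1) xs(1) True by (intro exI[of _ "insert xs Ps"] exI[of _ Cs]) simp
      next
        case False
        have "pairwise_disjoint Ps (insert xs Cs)"
          using dj P'(2) C'(2) unfolding pairwise_disjoint_def by blast
        moreover have "moves Ps (insert xs Cs) = R"
          using moves_insert(2)[of Ps xs Cs] TR mv False by (auto simp: T_def)
        ultimately show ?thesis
          using P'(1) C'(1) xs False by (intro exI[of _ Ps] exI[of _ "insert xs Cs"]) simp
      qed
    qed
  qed
qed

section \<open>Exchanging one component between two rank-maximal matchings\<close>

definition swap :: "'a set \<Rightarrow> ('a \<times> 'q) set \<Rightarrow> ('a \<times> 'q) set \<Rightarrow> ('a \<times> 'q) set" where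
  "swap B M M' = {(a,q) \<in> M. a \<notin> B} \<union> {(a,q) \<in> M'. a \<in> B}"

text \<open>The two exchanged sets together use the edges of \<open>M\<close> and of
  \<open>M'\<close> once each. The second equation is additive to avoid subtraction of
  naturals.\<close>

lemma sum_swap:
  fixes f :: "'a \<times> 'q \<Rightarrow> nat"
  assumes "finite M" "finite M'"
  shows "sum f (swap B M M') + sum f (swap B M' M) = sum f M + sum f M'"
    and "sum f (swap B M M') + sum f {(a,q) \<in> M. a \<in> B} = sum f M + sum f {(a,q) \<in> M'. a \<in> B}"
proof -
  have sw: "sum f (swap B X Y) = sum f {(a,q) \<in> X. a \<notin> B} + sum f {(a,q) \<in> Y. a \<in> B}"
    if "finite X" "finite Y" for X Y :: "('a \<times> 'q) set"
  proof -
    have "finite {(a,q) \<in> X. a \<notin> B}" "finite {(a,q) \<in> Y. a \<in> B}"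
      using that by (auto intro: finite_subset[of _ X] finite_subset[of _ Y])
    then show ?thesis unfolding swap_def by (intro sum.union_disjoint) auto
  qed
  have self: "swap B X X = X" for X :: "('a \<times> 'q) set" by (auto simp: swap_def)
  show "sum f (swap B M M') + sum f (swap B M' M) = sum f M + sum f M'"
    using sw[OF assms] sw[OF assms(2,1)] sw[OF assms(1,1)] sw[OF assms(2,2)] self by simp
  show "sum f (swap B M M') + sum f {(a,q) \<in> M. a \<in> B} = sum f M + sum f {(a,q) \<in> M'. a \<in> B}"
    using sw[OF assms] sw[OF assms(1,1)] self by simp
qed

context ranked_graph
begin

lemma rank_maximal_nth_signature_le:
  assumes "rank_maximal F \<rho> r M" "matching F N" "i \<le> r"
    and "\<And>j. j < i \<Longrightarrow> signature \<rho> r N ! j = signature \<rho> r M ! j"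
  shows "signature \<rho> r N ! i \<le> signature \<rho> r M ! i"
proof (rule ccontr)
  assume "\<not> ?thesis"
  then have "lex_gt (signature \<rho> r N) (signature \<rho> r M)"
    unfolding lex_gt_def length_signature using assms(3,4) by (intro exI[of _ i]) auto
  then show False using assms(1,2) by (auto simp: rank_maximal_def)
qed

text \<open>With equal earlier entries, maximality bounds the entries of \<open>N\<close> and
  \<open>N'\<close> by the common entry x of \<open>M\<close> and \<open>M'\<close>; two numbers at
  most x with sum 2x both equal x.\<close>

lemma signature_eq_if_sum_eq:
  assumes M: "rank_maximal F \<rho> r M" "rank_maximal F \<rho> r M'" and N: "matching F N" "matching F N'"
    and sum: "\<And>j. j \<le> r \<Longrightarrow> signature \<rho> r N ! j + signature \<rho> r N' ! j
                          = signature \<rho> r M ! j + signature \<rho> r M' ! j"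
  shows "i \<le> r \<Longrightarrow> signature \<rho> r N ! i = signature \<rho> r M ! i"
proof -
  have mM: "matching F M" "matching F M'" using M by (auto simp: rank_maximal_def)
  let ?s = "signature \<rho> r"
  have "?s M' ! i = ?s M ! i \<and> ?s N ! i = ?s M ! i \<and> ?s N' ! i = ?s M ! i" if "i \<le> r" for i
    using that
  proof (induction i rule: less_induct)
    case (less i)
    then have IH: "?s M' ! j = ?s M ! j" "?s N ! j = ?s M ! j" "?s N' ! j = ?s M ! j" if "j < i" for j
      using that by auto
    have "?s M' ! i \<le> ?s M ! i" "?s M ! i \<le> ?s M' ! i" "?s N ! i \<le> ?s M ! i" "?s N' ! i \<le> ?s M ! i"
      using rank_maximal_nth_signature_le[OF M(1) mM(2) less.prems]
        rank_maximal_nth_signature_le[OF M(2) mM(1) less.prems]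
        rank_maximal_nth_signature_le[OF M(1) N(1) less.prems]
        rank_maximal_nth_signature_le[OF M(1) N(2) less.prems] IH by simp_all
    then show ?case using sum[OF less.prems] by simp
  qed
  then show "i \<le> r \<Longrightarrow> ?s N ! i = ?s M ! i" by blast
qed

lemma nth_signature_sum:
  assumes "finite N" "i \<le> r"
  shows "signature \<rho> r N ! i = (\<Sum>(a,q)\<in>N. if \<rho> a q = i + 1 then 1 else 0)"
proof -
  have "(\<Sum>(a,q)\<in>N. if \<rho> a q = i + 1 then 1 else (0::nat)) = card {e \<in> N. \<rho> (fst e) (snd e) = i + 1}"
    using sum.inter_filter[OF assms(1), of "\<lambda>_. 1::nat" "\<lambda>e. \<rho> (fst e) (snd e) = i + 1"]
    by (simp add: case_prod_beta)
  also have "{e \<in> N. \<rho> (fst e) (snd e) = i + 1} = {(a,q) \<in> N. \<rho> a q = i + 1}" by auto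
  finally show ?thesis using assms(2) by (simp add: nth_signature)
qed

text \<open>Grouping by rank shows that the total rank depends only on the signature; this turns
  equal signatures into weight zero.\<close>

lemma sum_rank:
  assumes "N \<subseteq> F"
  shows "(\<Sum>(a,q)\<in>N. \<rho> a q) = (\<Sum>i\<le>r. (i + 1) * signature \<rho> r N ! i)"
proof -
  have fN: "finite N" using assms finF by (rule finite_subset)
  let ?g = "\<lambda>(a,q). \<rho> a q - 1"
  have *: "\<rho> a q - 1 = i \<longleftrightarrow> \<rho> a q = i + 1" "\<rho> a q - 1 \<le> r" if "(a,q) \<in> N" for a q i
  proof -
    have "1 \<le> \<rho> a q \<and> \<rho> a q \<le> r + 1" using rank that assms by blast
    then show "\<rho> a q - 1 = i \<longleftrightarrow> \<rho> a q = i + 1" "\<rho> a q - 1 \<le> r" by auto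
  qed
  have "(\<Sum>(a,q)\<in>N. \<rho> a q) = (\<Sum>i\<le>r. \<Sum>(a,q)\<in>{e \<in> N. ?g e = i}. \<rho> a q)"
    using *(2) by (intro sum.group[symmetric] fN) auto
  also have "\<dots> = (\<Sum>i\<le>r. (i + 1) * signature \<rho> r N ! i)"
  proof (intro sum.cong refl)
    fix i assume "i \<in> {..r}"
    have eq: "{e \<in> N. ?g e = i} = {(a,q) \<in> N. \<rho> a q = i + 1}" using *(1) by auto
    have "(\<Sum>(a,q)\<in>{(a,q) \<in> N. \<rho> a q = i + 1}. \<rho> a q) = (\<Sum>e\<in>{(a,q) \<in> N. \<rho> a q = i + 1}. i + 1)"
      by (intro sum.cong) auto
    then show "(\<Sum>(a,q)\<in>{e \<in> N. ?g e = i}. \<rho> a q) = (i + 1) * signature \<rho> r N ! i"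
      using \<open>i \<in> {..r}\<close> unfolding eq by (simp add: nth_signature)
  qed
  finally show ?thesis .
qed

end

section \<open>Posts moved between two rank-maximal matchings and their weights\<close>

locale two_rank_maximal = ranked_graph A Q F \<rho> r
  for A :: "'a set" and Q :: "'q set" and F \<rho> r +
  fixes M M' :: "('a \<times> 'q) set"
  assumes M: "rank_maximal F \<rho> r M" and M': "rank_maximal F \<rho> r M'"
    and DM: "Domain M = A" and DM': "Domain M' = A"
begin

lemma mM: "matching F M" and mM': "matching F M'"
  using M M' by (simp_all add: rank_maximal_def)

lemma MF: "M \<subseteq> F" and MF': "M' \<subseteq> F"
  using mM mM' by (auto dest: matching_subset)

lemma finM: "finite M" and finM': "finite M'"
  using MF MF' finF finite_subset by blast+

text \<open>An applicant that keeps its post gives no pair, in accordance with the absence of loops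
  in \<open>sw_edge\<close>.\<close>

definition shifts :: "('q \<times> 'q) set" where
  "shifts = {(q,q'). q \<noteq> q' \<and> (\<exists>a. (a,q) \<in> M \<and> (a,q') \<in> M')}"

lemma shifts_Q: "shifts \<subseteq> Q \<times> Q"
  using MF MF' F by (auto simp: shifts_def)

sublocale partial_injection shifts
proof
  show "finite shifts" using shifts_Q finQ by (meson finite_SigmaI finite_subset)
  show "(p,q) \<in> shifts \<Longrightarrow> (p,q') \<in> shifts \<Longrightarrow> q = q'" for p q q'
    unfolding shifts_def using matching_eq1[OF mM'] matching_eq2[OF mM] by blast
  show "(p,q) \<in> shifts \<Longrightarrow> (p',q) \<in> shifts \<Longrightarrow> p = p'" for p q p'
    unfolding shifts_def using matching_eq1[OF mM] matching_eq2[OF mM'] by blast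
qed

lemma mate_eq: "(a,q) \<in> M \<Longrightarrow> mate M q = a"
  unfolding mate_def using matching_eq2[OF mM] by blast

lemma shifts_mate:
  assumes "(q,q') \<in> shifts"
  shows "(mate M q, q) \<in> M" "(mate M q, q') \<in> M'" "q \<noteq> q'"
  using assms mate_eq unfolding shifts_def by blast+

lemma shift_of_applicant:
  assumes "a \<in> A"
  obtains q q' where "(a,q) \<in> M" "(a,q') \<in> M'" "q = q' \<or> (q,q') \<in> shifts"
  using assms DM DM' unfolding shifts_def by blast

lemma sw_edge_shifts: "(q,q') \<in> shifts \<Longrightarrow> sw_edge A Q F \<rho> r M q q'"
  using shifts_Q shifts_mate rank_maximal_subset_reduced[OF M'] unfolding sw_edge_def by blast

text \<open>An \<open>M\<close>-partner of \<open>q\<close> would keep \<open>q\<close> in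
  \<open>M'\<close>, as nothing moves away from \<open>q\<close>; but in \<open>M'\<close> the post
  belongs to the applicant coming from \<open>p\<close>, who holds a different post in
  \<open>M\<close>.\<close>

lemma not_in_Domain_shifts:
  assumes "(p,q) \<in> shifts" "q \<notin> Domain shifts"
  shows "q \<notin> Range M"
proof
  assume "q \<in> Range M"
  then obtain a where a: "(a,q) \<in> M" by auto
  then have "a \<in> A" using DM by auto
  then obtain q' where q': "(a,q') \<in> M'" using DM' by auto
  have "q' = q"
  proof (rule ccontr)
    assume "q' \<noteq> q"
    then have "(q,q') \<in> shifts" using a q' by (auto simp: shifts_def)
    then show False using assms(2) by blast
  qed
  then have "mate M p = a" using matching_eq2[OF mM' shifts_mate(2)[OF assms(1)]] q' by simp
  then show False using matching_eq1[OF mM a] shifts_mate[OF assms(1)] by auto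
qed

lemma is_sink_if:
  assumes "(p,q) \<in> shifts" "q \<notin> Domain shifts"
  shows "is_sink A Q F \<rho> r M q"
proof -
  have "q \<in> Q" "q \<notin> Range M" using not_in_Domain_shifts[OF assms] assms(1) shifts_Q by auto
  then show ?thesis using unmatched_imp_even_Gi[OF M] by (auto simp: is_sink_def sw_edge_def)
qed

context
  fixes T X assumes T: "closed_under shifts T X"
begin

definition movers :: "'a set" where
  "movers = {a. \<exists>q q'. (a,q) \<in> M \<and> (q,q') \<in> T}"

lemma T_shifts: "(q,q') \<in> T \<Longrightarrow> (q,q') \<in> shifts \<and> q \<in> X \<and> q' \<in> X"
  using T unfolding closed_under_def by blast

lemma T_closed: "(q,q') \<in> shifts \<Longrightarrow> q \<in> X \<or> q' \<in> X \<Longrightarrow> (q,q') \<in> T"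
  using T unfolding closed_under_def by blast

lemma moversD:
  assumes "a \<in> movers"
  obtains q q' where "(a,q) \<in> M" "(a,q') \<in> M'" "(q,q') \<in> T"
proof -
  from assms obtain q q' where "(a,q) \<in> M" "(q,q') \<in> T" by (auto simp: movers_def)
  moreover from this have "(a,q') \<in> M'" using T_shifts shifts_mate(2) mate_eq by blast
  ultimately show thesis using that by blast
qed

text \<open>Posts of movers lie in \<open>X\<close>, and closedness puts any move touching
  \<open>X\<close> into \<open>T\<close>. Hence exchanging the edges of movers creates no conflict
  at a post.\<close>

lemma not_mover_post:
  assumes "(a,q) \<in> M \<or> (a,q) \<in> M'" "a \<notin> movers"
    "(b,q) \<in> M \<or> (b,q) \<in> M'" "b \<in> movers"
  shows False
proof -
  obtain p p' where b: "(b,p) \<in> M" "(b,p') \<in> M'" "(p,p') \<in> T" using assms(4) by (rule moversD)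
  have "q = p \<or> q = p'" using assms(3) b matching_eq1[OF mM] matching_eq1[OF mM'] by blast
  then have qX: "q \<in> X" using b T_shifts by blast
  have "a \<in> A" using assms(1) DM DM' by auto
  then obtain s s' where s: "(a,s) \<in> M" "(a,s') \<in> M'" "s = s' \<or> (s,s') \<in> shifts"
    by (rule shift_of_applicant)
  have q: "q = s \<or> q = s'" using assms(1) s matching_eq1[OF mM] matching_eq1[OF mM'] by blast
  have ab: "a \<noteq> b" using assms by blast
  have "s \<noteq> s'"
  proof
    assume "s = s'"
    then have "(a,q) \<in> M" "(a,q) \<in> M'" using q s by auto
    then show False using assms(3) ab matching_eq2[OF mM] matching_eq2[OF mM'] by blast
  qed
  then have "(s,s') \<in> T" using T_closed s(3) q qX by blast
  then show False using assms(2) s(1) by (auto simp: movers_def)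
qed

lemma matching_swap:
  assumes "matching F N" "matching F N'" "N \<subseteq> M \<union> M'" "N' \<subseteq> M \<union> M'"
  shows "matching F (swap movers N N')"
  unfolding matching_def
proof (intro conjI allI impI)
  show "swap movers N N' \<subseteq> F" using assms(1,2) by (auto simp: swap_def dest: matching_subset)
next
  fix a q q' assume "(a,q) \<in> swap movers N N'" "(a,q') \<in> swap movers N N'"
  then show "q = q'"
    unfolding swap_def using matching_eq1[OF assms(1)] matching_eq1[OF assms(2)] by blast
next
  fix a a' q assume *: "(a,q) \<in> swap movers N N'" "(a',q) \<in> swap movers N N'"
  have "(a,q) \<in> M \<or> (a,q) \<in> M'" "(a',q) \<in> M \<or> (a',q) \<in> M'"
    using * assms(3,4) by (auto simp: swap_def)
  then have "a \<in> movers \<longleftrightarrow> a' \<in> movers" using not_mover_post by blast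
  then show "a = a'"
    using * matching_eq2[OF assms(1)] matching_eq2[OF assms(2)] unfolding swap_def by blast
qed

lemma sum_rank_movers:
  "(\<Sum>(a,q)\<in>{(a,q) \<in> M'. a \<in> movers}. \<rho> a q) = (\<Sum>(a,q)\<in>{(a,q) \<in> M. a \<in> movers}. \<rho> a q)"
proof -
  let ?N = "swap movers M M'" and ?N' = "swap movers M' M"
  have m: "matching F ?N" "matching F ?N'"
    using matching_swap[OF mM mM'] matching_swap[OF mM' mM] by auto
  then have NF: "?N \<subseteq> F" "?N' \<subseteq> F" by (auto dest: matching_subset)
  have fin: "finite ?N" "finite ?N'" using NF finF finite_subset by blast+
  have "signature \<rho> r ?N ! i + signature \<rho> r ?N' ! i = signature \<rho> r M ! i + signature \<rho> r M' ! i"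
    if "i \<le> r" for i
    unfolding nth_signature_sum[OF fin(1) that] nth_signature_sum[OF fin(2) that]
      nth_signature_sum[OF finM that] nth_signature_sum[OF finM' that]
    by (rule sum_swap(1)[OF finM finM'])
  then have "signature \<rho> r ?N ! i = signature \<rho> r M ! i" if "i \<le> r" for i
    using signature_eq_if_sum_eq[OF M M' m _ that] by blast
  then have "(\<Sum>(a,q)\<in>?N. \<rho> a q) = (\<Sum>(a,q)\<in>M. \<rho> a q)"
    unfolding sum_rank[OF NF(1)] sum_rank[OF MF] by (intro sum.cong) auto
  \<comment> \<open>The exchanged matching and \<open>M\<close> have equal total rank, so what
    enters and what leaves balance.\<close>
  then show ?thesis using sum_swap(2)[OF finM finM', of "\<lambda>(a,q). \<rho> a q" movers] by linarith
qed

text \<open>Indexes the edges of movers by the moves in \<open>T\<close>, so that their total ranks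
  become sums over edges of the switching graph.\<close>

lemma movers_image:
  "{(a,q) \<in> M. a \<in> movers} = (\<lambda>(q,q'). (mate M q, q)) ` T"
  "{(a,q) \<in> M'. a \<in> movers} = (\<lambda>(q,q'). (mate M q, q')) ` T"
proof -
  have 1: "(mate M q, q) \<in> M" "(mate M q, q') \<in> M'" "mate M q \<in> movers" if "(q,q') \<in> T" for q q'
    using that T_shifts[OF that] shifts_mate unfolding movers_def by blast+
  have 2: "(a,q) \<in> (\<lambda>(q,q'). (mate M q, q)) ` T" if aq: "(a,q) \<in> M" "a \<in> movers" for a q
  proof -
    obtain p p' where p: "(a,p) \<in> M" "(p,p') \<in> T" using aq(2) by (rule moversD)
    then have "p = q" "mate M p = a" using matching_eq1[OF mM aq(1)] mate_eq by auto
    then show ?thesis using p(2) by force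
  qed
  have 3: "(a,q) \<in> (\<lambda>(q,q'). (mate M q, q')) ` T" if aq: "(a,q) \<in> M'" "a \<in> movers" for a q
  proof -
    obtain p p' where p: "(a,p) \<in> M" "(a,p') \<in> M'" "(p,p') \<in> T" using aq(2) by (rule moversD)
    then have "p' = q" "mate M p = a" using matching_eq1[OF mM' aq(1)] mate_eq by auto
    then show ?thesis using p(3) by force
  qed
  show "{(a,q) \<in> M. a \<in> movers} = (\<lambda>(q,q'). (mate M q, q)) ` T" using 1 2 by fast
  show "{(a,q) \<in> M'. a \<in> movers} = (\<lambda>(q,q'). (mate M q, q')) ` T" using 1 3 by fast
qed

lemma sum_sw_weight_closed: "(\<Sum>(q,q')\<in>T. sw_weight \<rho> M q q') = 0"
proof -
  have i1: "inj_on (\<lambda>(q,q'). (mate M q, q)) T"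
    by (clarsimp simp: inj_on_def) (metis T_shifts functional)
  have i2: "inj_on (\<lambda>(q,q'). (mate M q, q')) T"
    by (clarsimp simp: inj_on_def) (metis T_shifts injective)
  have "(\<Sum>(q,q')\<in>T. \<rho> (mate M q) q') = (\<Sum>(q,q')\<in>T. \<rho> (mate M q) q)"
    using sum_rank_movers unfolding movers_image sum.reindex[OF i1] sum.reindex[OF i2]
    by (simp add: case_prod_beta)
  then have "(\<Sum>(q,q')\<in>T. int (\<rho> (mate M q) q')) = (\<Sum>(q,q')\<in>T. int (\<rho> (mate M q) q))"
    by (simp add: case_prod_beta flip: of_nat_sum)
  then show ?thesis by (simp add: sw_weight_def case_prod_beta sum_subtractf)
qed

end

section \<open>Components as switching paths and cycles\<close>

lemma switching_path_if:
  assumes "path_component shifts xs" "set xs \<subseteq> Field shifts"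
  shows "switching_path A Q F \<rho> r M xs"
proof -
  have l: "xs \<noteq> []" "distinct xs" "\<And>i. Suc i < length xs \<Longrightarrow> (xs ! i, xs ! Suc i) \<in> shifts"
    and hl: "hd xs \<notin> Range shifts" "last xs \<notin> Domain shifts"
    using assms(1) by (auto simp: path_component_def linked_def)
  have "set xs \<subseteq> Q" using assms(2) shifts_Q by (auto simp: Field_def)
  moreover have "is_sink A Q F \<rho> r M (last xs)"
  proof -
    have "last xs \<in> Field shifts" using assms(2) l(1) by auto
    then show ?thesis using hl(2) is_sink_if by (auto simp: Field_def)
  qed
  moreover have "(\<Sum>i < length xs - 1. sw_weight \<rho> M (xs ! i) (xs ! Suc i)) = 0"
  proof -
    have "inj_on (\<lambda>i. (xs ! i, xs ! Suc i)) {..<length xs - 1}"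
      using l(2) by (auto simp: inj_on_def nth_eq_iff_index_eq)
    then show ?thesis
      using sum_sw_weight_closed[OF path_component_closed[OF assms(1)]]
      by (simp add: moves_path sum.reindex)
  qed
  ultimately show ?thesis using l sw_edge_shifts by (simp add: switching_path_def)
qed

lemma switching_cycle_if:
  assumes "cycle_component shifts xs" "set xs \<subseteq> Field shifts"
  shows "switching_cycle A Q F \<rho> r M xs"
proof -
  have l: "xs \<noteq> []" "distinct xs"
    using assms(1) by (auto simp: cycle_component_def linked_def)
  have "set xs \<subseteq> Q" using assms(2) shifts_Q by (auto simp: Field_def)
  moreover have "(\<Sum>i < length xs. sw_weight \<rho> M (xs ! i) (xs ! (Suc i mod length xs))) = 0"
  proof -
    have "inj_on (\<lambda>i. (xs ! i, xs ! (Suc i mod length xs))) {..<length xs}"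
      using l(2) by (auto simp: inj_on_def nth_eq_iff_index_eq)
    then show ?thesis
      using sum_sw_weight_closed[OF cycle_component_closed[OF assms(1)]]
      by (simp add: moves_cycle sum.reindex)
  qed
  ultimately show ?thesis
    using l sw_edge_shifts cycle_component_nth[OF assms(1)] by (simp add: switching_cycle_def)
qed

text \<open>Both matchings cover all applicants, so each applicant either keeps its post, which is
  then outside the domain of \<open>shifts\<close>, or moves along exactly one pair.\<close>

lemma apply_switch_shifts: "M' = apply_switch M shifts"
proof (intro set_eqI iffI)
  fix e assume e: "e \<in> M'"
  obtain a q' where aq: "e = (a,q')" by (cases e)
  then have "a \<in> A" using e DM' by auto
  then obtain q where q: "(a,q) \<in> M" using DM by auto
  have "(q,q') \<in> shifts \<or> q = q' \<and> q \<notin> Domain shifts"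
  proof (cases "q = q'")
    case True
    have "(q,p) \<notin> shifts" for p
    proof
      assume "(q,p) \<in> shifts"
      then have "(a,p) \<in> M'" "q \<noteq> p" using shifts_mate mate_eq[OF q] by blast+
      then show False using matching_eq1[OF mM'] e aq True by blast
    qed
    then show ?thesis using True by blast
  next
    case False
    then show ?thesis using q e aq by (auto simp: shifts_def)
  qed
  then show "e \<in> apply_switch M shifts" using q aq by (auto simp: apply_switch_def)
next
  fix e assume e: "e \<in> apply_switch M shifts"
  obtain a q' where aq: "e = (a,q')" by (cases e)
  show "e \<in> M'"
  proof (cases "(a,q') \<in> M \<and> q' \<notin> Domain shifts")
    case True
    then have "a \<in> A" using DM by auto
    then obtain q q'' where q: "(a,q) \<in> M" "(a,q'') \<in> M'" "q = q'' \<or> (q,q'') \<in> shifts"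
      by (rule shift_of_applicant)
    then have "q = q'" using True matching_eq1[OF mM] by blast
    then show ?thesis using True q aq by blast
  next
    case False
    then obtain q where "(a,q) \<in> M" "(q,q') \<in> shifts"
      using e aq by (auto simp: apply_switch_def)
    then show ?thesis using shifts_mate(2) mate_eq aq by blast
  qed
qed

end

section \<open>Last-resort posts and the conclusion\<close>

lemma rank_maximal_Domain:
  assumes "instance_wf A P E rk r" and M: "rank_maximal (lr_edges A E) (lr_rank rk r) r M"
  shows "Domain M = A"
proof
  interpret ranked_graph A "lr_posts A P" "lr_edges A E" "lr_rank rk r" r
    using assms(1) by unfold_locales
      (auto simp: instance_wf_def lr_posts_def lr_edges_def lr_rank_def)
  have mM: "matching (lr_edges A E) M" using M by (simp add: rank_maximal_def)
  have MF: "M \<subseteq> lr_edges A E" using mM by (rule matching_subset)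
  then show "Domain M \<subseteq> A" using F by blast
  show "A \<subseteq> Domain M"
  proof (rule subsetI, rule ccontr)
    fix a assume a: "a \<in> A" "a \<notin> Domain M"
    \<comment> \<open>The last-resort post of \<open>a\<close> is adjacent to no other applicant, so
      the edge can be added.\<close>
    let ?N = "insert (a, Inr a) M"
    have "(b, Inr a) \<notin> M" for b using MF a(2) by (auto simp: lr_edges_def)
    then have N: "matching (lr_edges A E) ?N"
      using mM a unfolding matching_def lr_edges_def by blast
    have fM: "finite M" using MF finF by (rule finite_subset)
    have up: "upto_rank (lr_rank rk r) (r + 1) X = X" if "X \<subseteq> lr_edges A E" for X
      using rank that by auto
    have "card ?N = Suc (card M)" using a(2) fM by (auto simp: card_insert_if)
    then have "card (upto_rank (lr_rank rk r) (r + 1) M) < card (upto_rank (lr_rank rk r) (r + 1) ?N)"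
      using up[OF MF] up[OF matching_subset[OF N]] by simp
    \<comment> \<open>The new edge has rank r + 1 and changes only the last entry of the signature,
      at position \<open>r\<close>.\<close>
    moreover have "upto_rank (lr_rank rk r) (j + 1) ?N = upto_rank (lr_rank rk r) (j + 1) M"
      if "j < r" for j
      using that by (auto simp: upto_rank_def lr_rank_def)
    ultimately have "lex_gt (signature (lr_rank rk r) r ?N) (signature (lr_rank rk r) r M)"
      using lex_gt_signature_if[OF mM N order_refl] by metis
    then show False using M N by (auto simp: rank_maximal_def)
  qed
qed

theorem theorem1:
  fixes A :: "'a set" and P :: "'p set" and E :: "('a \<times> 'p) set"
    and rk :: "'a \<Rightarrow> 'p \<Rightarrow> nat" and r :: nat
    and M M' :: "('a \<times> ('p + 'a)) set"
  assumes "instance_wf A P E rk r"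
    and "rank_maximal (lr_edges A E) (lr_rank rk r) r M"
    and "rank_maximal (lr_edges A E) (lr_rank rk r) r M'"
  shows "\<exists>Ps Cs.
    (\<forall>qs \<in> Ps. switching_path A (lr_posts A P) (lr_edges A E) (lr_rank rk r) r M qs) \<and>
    (\<forall>qs \<in> Cs. switching_cycle A (lr_posts A P) (lr_edges A E) (lr_rank rk r) r M qs) \<and>
    (\<forall>xs \<in> Ps. \<forall>ys \<in> Ps. xs \<noteq> ys \<longrightarrow> set xs \<inter> set ys = {}) \<and>
    (\<forall>xs \<in> Cs. \<forall>ys \<in> Cs. xs \<noteq> ys \<longrightarrow> set xs \<inter> set ys = {}) \<and>
    (\<forall>xs \<in> Ps. \<forall>ys \<in> Cs. set xs \<inter> set ys = {}) \<and>
    M' = apply_switch M (moves Ps Cs)"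
proof -
  have "Domain M = A" "Domain M' = A" using rank_maximal_Domain assms by blast+
  then interpret two_rank_maximal A "lr_posts A P" "lr_edges A E" "lr_rank rk r" r M M'
    using assms by unfold_locales
      (auto simp: instance_wf_def lr_posts_def lr_edges_def lr_rank_def)
  obtain Ps Cs where "\<forall>xs\<in>Ps. path_component shifts xs \<and> set xs \<subseteq> Field shifts"
    "\<forall>xs\<in>Cs. cycle_component shifts xs \<and> set xs \<subseteq> Field shifts"
    "pairwise_disjoint Ps Cs" "moves Ps Cs = shifts"
    using decomposition[OF partial_injection_axioms] by metis
  then show ?thesis
    using switching_path_if switching_cycle_if apply_switch_shifts
    unfolding pairwise_disjoint_def by (intro exI[of _ Ps] exI[of _ Cs]) simp
qed

end
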